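(* Let $G=(L\cup R,\mathcal{E})$ be a bipartite graph with left degree $D$ that has $(r,K,\epsilon)$ bounded right degree, where $r,K\ge 1$ are integers and $\epsilon>0$. Then $G$ admits $((1-4\epsilon)D,\ 2\lceil\log_2 K\rceil r)$ online matching up to size $K$. Furthermore, if $G$ is explicit, then there is an algorithm computing such an assignment function $f(S,x)$ with running time $\mathrm{poly}(K,D,\log|L|)$.
   Context: Bipartite graphs may have multiple edges ($\mathcal{E}$ a multiset); left degree $D$ means every left node has exactly $D$ incident edges; $\mathcal{N}(x)$ is the multiset of neighbors of $x$, $N(S)$ the set of right nodes adjacent to some node of $S$, and $\mathcal{E}(S,\{p\})$ the multiset of edges between $S$ and $p$. Multiset size counts multiplicities. Bounded right degree: $\mathrm{excess}_S(p,r)=\max(|\mathcal{E}(S,\{p\})|-r,0)$, $\mathrm{excess}_S(r)=\sum_{p\in N(S)}\mathrm{excess}_S(p,r)$; $G$ has $(r,K,\epsilon)$ bounded right degree if $\mathrm{excess}_S(r)\le\epsilon D|S|$ for every $S\subseteq L$ with $|S|\le K$. Online matching: $G$ admits $(\ell,r')$ online matching up to size $K$ if there is a function $f$ assigning to every list $S$ of elements of $L$ of length at most $K$ and every $x\in L$ a multiset $f(S,x)$ over $R$ such that: (1) $f(S,x)\subseteq\mathcal{N}(x)$ (as multisets); (2) $f(S,x)=\emptyset$ if $x$ does not occur in $S$; (3) if $x$ occurs in $S$ then $f(S',x)=f(S,x)$ for every list $S'$ of length at most $K$ having $S$ as a prefix; (4) if $x$ occurs in $S$ then $|f(S,x)|\ge\ell$;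 (5) for every $p\in R$ at most $r'$ distinct $x$ occurring in $S$ have $p\in f(S,x)$. $G$ is explicit if it belongs to a family of graphs indexed by $\log|L|$ and there is an algorithm running in time $\mathrm{poly}(\log|L|)$ that on input $x\in L$ and $i\in\{1,\dots,D\}$ outputs the $i$-th neighbor of $x$.
   Formalization: For K = 1 the printed bound 2⌈log₂K⌉r is 0 and the claim fails (a single edge, D = r = 1, ε = 1/8); the factor ⌈log₂K⌉ is replaced by max(1, ⌈log₂K⌉), which changes only the case K = 1, where the bound becomes 2r. *)

theory Defs
  imports
    Complex_Main
    "HOL-Library.Multiset"
    "HOL-Library.Sublist"
    "HOL-Computational_Algebra.Polynomial"
begin

section \<open>Bipartite multigraphs\<close>

record ('a, 'b) bigraph =
  left :: "'a set"
  right :: "'b set"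
  edges :: "('a \<times> 'b) multiset"

definition bipartite :: "('a, 'b) bigraph \<Rightarrow> bool" where
  "bipartite G \<longleftrightarrow>
     finite (left G) \<and> finite (right G) \<and> set_mset (edges G) \<subseteq> left G \<times> right G"

definition neighbors :: "('a, 'b) bigraph \<Rightarrow> 'a \<Rightarrow> 'b multiset" where
  "neighbors G x = image_mset snd {# e \<in># edges G. fst e = x #}"

definition left_degree :: "('a, 'b) bigraph \<Rightarrow> nat \<Rightarrow> bool" where
  "left_degree G D \<longleftrightarrow> (\<forall>x\<in>left G. size {# e \<in># edges G. fst e = x #} = D)"

definition nbr_set :: "('a, 'b) bigraph \<Rightarrow> 'a set \<Rightarrow> 'b set" where
  "nbr_set G S = {p \<in> right G. \<exists>x\<in>S. (x, p) \<in># edges G}"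

definition edges_between :: "('a, 'b) bigraph \<Rightarrow> 'a set \<Rightarrow> 'b \<Rightarrow> ('a \<times> 'b) multiset" where
  "edges_between G S p = {# e \<in># edges G. fst e \<in> S \<and> snd e = p #}"

text \<open>Subtraction on \<^typ>\<open>nat\<close> is truncated, so this is \<open>max (|E(S,{p})| - r) 0\<close>.\<close>

definition excess_at :: "('a, 'b) bigraph \<Rightarrow> 'a set \<Rightarrow> 'b \<Rightarrow> nat \<Rightarrow> nat" where
  "excess_at G S p r = size (edges_between G S p) - r"

definition excess :: "('a, 'b) bigraph \<Rightarrow> 'a set \<Rightarrow> nat \<Rightarrow> nat" where
  "excess G S r = (\<Sum>p\<in>nbr_set G S. excess_at G S p r)"

definition bounded_right_degree ::
    "('a, 'b) bigraph \<Rightarrow> nat \<Rightarrow> nat \<Rightarrow> nat \<Rightarrow> real \<Rightarrow> bool" where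
  "bounded_right_degree G D r K \<epsilon> \<longleftrightarrow>
     (\<forall>S \<subseteq> left G. card S \<le> K \<longrightarrow> real (excess G S r) \<le> \<epsilon> * real D * real (card S))"


section \<open>Online matching\<close>

definition online_matching_fun ::
    "('a, 'b) bigraph \<Rightarrow> real \<Rightarrow> nat \<Rightarrow> nat \<Rightarrow> ('a list \<Rightarrow> 'a \<Rightarrow> 'b multiset) \<Rightarrow> bool" where
  "online_matching_fun G l r' K f \<longleftrightarrow>
     (\<forall>S. set S \<subseteq> left G \<and> length S \<le> K \<longrightarrow>
        (\<forall>x\<in>left G.
           f S x \<subseteq># neighbors G x \<and>
           (x \<notin> set S \<longrightarrow> f S x = {#}) \<and>
           (x \<in> set S \<longrightarrow>
              (\<forall>S'. set S' \<subseteq> left G \<and> length S' \<le> K \<and> prefix S S' \<longrightarrow> f S' x = f S x)) \<and>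
           (x \<in> set S \<longrightarrow> real (size (f S x)) \<ge> l)) \<and>
        (\<forall>p\<in>right G. card {x \<in> set S. p \<in># f S x} \<le> r'))"

definition admits_online_matching ::
    "('a, 'b) bigraph \<Rightarrow> real \<Rightarrow> nat \<Rightarrow> nat \<Rightarrow> bool" where
  "admits_online_matching G l r' K \<longleftrightarrow> (\<exists>f. online_matching_fun G l r' K f)"

text \<open>
  With \<open>r' = 2 \<lceil>log 2 K\<rceil> r\<close> the case \<open>K = 1\<close> has to be excluded or adjusted: the bound is then
  \<open>0\<close>, and no nonempty assignment is possible. The following lemma shows that a single edge is
  a counterexample. This is why \<open>max 1 \<lceil>log 2 K\<rceil>\<close>, which is \<open>\<lceil>log 2 K\<rceil>\<close> for every
  \<open>K \<ge> 2\<close>, is used as the factor.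
\<close>

lemma log_factor_K_ge_2:
  assumes "K \<ge> 2"
  shows "max 1 (nat \<lceil>log 2 (real K)\<rceil>) = nat \<lceil>log 2 (real K)\<rceil>"
proof -
  have "log 2 2 \<le> log 2 (real K)" using assms by (subst log_le_cancel_iff) auto
  then have "1 \<le> \<lceil>log 2 (real K)\<rceil>" by (simp add: le_ceiling_iff)
  then show ?thesis by linarith
qed

lemma counterexample_K_eq_1:
  fixes G :: "(nat, nat) bigraph"
  defines "G \<equiv> \<lparr>left = {0}, right = {0}, edges = {#(0, 0)#}\<rparr>"
  shows "bipartite G" "left_degree G 1" "bounded_right_degree G 1 1 1 (1/8)"
    and "\<not> admits_online_matching G ((1 - 4 * (1/8)) * real 1)
           (2 * nat \<lceil>log 2 (real 1)\<rceil> * 1) 1"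
proof -
  show "bipartite G"
    by (simp add: G_def bipartite_def)
  show "left_degree G 1"
    by (simp add: G_def left_degree_def)
  have "excess_at G S p 1 = 0" for S p
    by (simp add: G_def excess_at_def edges_between_def)
  then show "bounded_right_degree G 1 1 1 (1/8)"
    by (simp add: bounded_right_degree_def excess_def)
  have False if f: "online_matching_fun G l r' 1 f" and l: "l > 0" and r': "r' = 0"
    for f l and r' :: nat
  proof -
    have S: "set [0] \<subseteq> left G \<and> length [0] \<le> 1" and x: "0 \<in> left G" and p: "0 \<in> right G"
      by (simp_all add: G_def)
    have "l \<le> real (size (f [0] 0))"
      using f S x unfolding online_matching_fun_def by (metis list.set_intros(1))
    with l have "f [0] 0 \<noteq> {#}" by (metis size_empty of_nat_0 not_le)
    moreover have "set_mset (f [0] 0) \<subseteq> {0}"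
    proof -
      have "f [0] 0 \<subseteq># neighbors G 0"
        using f S x unfolding online_matching_fun_def by meson
      then show ?thesis
        by (drule_tac set_mset_mono) (simp add: neighbors_def G_def)
    qed
    ultimately have "0 \<in># f [0] 0"
      by (metis set_mset_eq_empty_iff singletonI subset_singletonD)
    then have "{x \<in> set [0]. 0 \<in># f [0] x} = {0}" by force
    moreover have "card {x \<in> set [0]. 0 \<in># f [0] x} \<le> r'"
      using f S p unfolding online_matching_fun_def by meson
    ultimately show False using r' by simp
  qed
  from this[of "(1 - 4 * (1/8)) * real 1" "2 * nat \<lceil>log 2 (real 1)\<rceil> * 1"]
  show "\<not> admits_online_matching G ((1 - 4 * (1/8)) * real 1)
          (2 * nat \<lceil>log 2 (real 1)\<rceil> * 1) 1"
    unfolding admits_online_matching_def by auto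
qed


section \<open>Algorithms\<close>

text \<open>
  The machine model is the language WHILE of N. D. Jones (Computability and Complexity: From a
  Programming Perspective, MIT Press 1997): variables range over binary trees, expressions are
  built from the tree operations, and the only test is whether a tree is the atom. Each
  operation costs one unit. Polynomial time in this model coincides with polynomial time on
  Turing machines, since trees can be kept as shared (DAG) structures; there is no unit-cost
  arithmetic and no unit-cost equality test on trees.
\<close>

datatype tree = Leaf | Node tree tree

datatype exp = Var nat | ELeaf | ENode exp exp | EHd exp | ETl exp

type_synonym state = "nat \<Rightarrow> tree"

fun head :: "tree \<Rightarrow> tree" where
  "head Leaf = Leaf"
| "head (Node a b) = a"

fun tail :: "tree \<Rightarrow> tree" where
  "tail Leaf = Leaf"
| "tail (Node a b) = b"

fun val :: "exp \<Rightarrow> state \<Rightarrow> tree" where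
  "val (Var v) s = s v"
| "val ELeaf s = Leaf"
| "val (ENode a b) s = Node (val a s) (val b s)"
| "val (EHd a) s = head (val a s)"
| "val (ETl a) s = tail (val a s)"

fun cost :: "exp \<Rightarrow> nat" where
  "cost (Var v) = 1"
| "cost ELeaf = 1"
| "cost (ENode a b) = 1 + cost a + cost b"
| "cost (EHd a) = 1 + cost a"
| "cost (ETl a) = 1 + cost a"

datatype com = Skip | Assign nat exp | Seq com com | If exp com com | While exp com

text \<open>\<open>exec c s t s'\<close>: started in \<open>s\<close>, program \<open>c\<close> halts in \<open>s'\<close> after exactly \<open>t\<close> time units.\<close>

inductive exec :: "com \<Rightarrow> state \<Rightarrow> nat \<Rightarrow> state \<Rightarrow> bool" where
  Skip: "exec Skip s 1 s"
| Assign: "exec (Assign v e) s (1 + cost e) (s(v := val e s))"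
| Seq: "exec c1 s1 t1 s2 \<Longrightarrow> exec c2 s2 t2 s3 \<Longrightarrow> exec (Seq c1 c2) s1 (t1 + t2) s3"
| IfTrue: "val e s \<noteq> Leaf \<Longrightarrow> exec c1 s t s' \<Longrightarrow> exec (If e c1 c2) s (1 + cost e + t) s'"
| IfFalse: "val e s = Leaf \<Longrightarrow> exec c2 s t s' \<Longrightarrow> exec (If e c1 c2) s (1 + cost e + t) s'"
| WhileFalse: "val e s = Leaf \<Longrightarrow> exec (While e c) s (1 + cost e) s"
| WhileTrue: "val e s1 \<noteq> Leaf \<Longrightarrow> exec c s1 t1 s2 \<Longrightarrow> exec (While e c) s2 t2 s3 \<Longrightarrow>
    exec (While e c) s1 (1 + cost e + t1 + t2) s3"

text \<open>Input and output are passed in variable 0; all other variables are initially \<^const>\<open>Leaf\<close>.\<close>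

definition computes_within :: "com \<Rightarrow> tree \<Rightarrow> tree \<Rightarrow> nat \<Rightarrow> bool" where
  "computes_within P input output T \<longleftrightarrow>
     (\<exists>t s. t \<le> T \<and> exec P ((\<lambda>_. Leaf)(0 := input)) t s \<and> s 0 = output)"

definition enc_bool :: "bool \<Rightarrow> tree" where
  "enc_bool b = (if b then Node Leaf Leaf else Leaf)"

fun enc_list :: "('a \<Rightarrow> tree) \<Rightarrow> 'a list \<Rightarrow> tree" where
  "enc_list enc [] = Leaf"
| "enc_list enc (x # xs) = Node (enc x) (enc_list enc xs)"

abbreviation enc_bits :: "bool list \<Rightarrow> tree" where
  "enc_bits \<equiv> enc_list enc_bool"

text \<open>Numbers are written in binary, least significant bit first, without leading zeros.\<close>

fun bits :: "nat \<Rightarrow> bool list" where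
  "bits n = (if n = 0 then [] else odd n # bits (n div 2))"

declare bits.simps [simp del]

abbreviation enc_nat :: "nat \<Rightarrow> tree" where
  "enc_nat n \<equiv> enc_bits (bits n)"


section \<open>Explicit families\<close>

text \<open>
  Nodes are bit strings. The graph with index \<open>n\<close> has as left nodes strings of length
  \<open>n = \<lceil>log 2 |L|\<rceil>\<close>; not all strings need be nodes, so \<open>|L|\<close> need not be a power of two. There
  need not be a graph for every \<open>n\<close>. The index of a neighbour is given in binary, since the
  degree may be superpolynomial in \<open>n\<close>. Here \<open>nb n x i\<close> is the \<open>i\<close>-th neighbour of \<open>x\<close> in \<open>G n\<close>.
\<close>

definition explicit_family ::
    "nat set \<Rightarrow> (nat \<Rightarrow> (bool list, bool list) bigraph) \<Rightarrow> (nat \<Rightarrow> nat) \<Rightarrow> bool" where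
  "explicit_family I G D \<longleftrightarrow>
     (\<forall>n\<in>I. bipartite (G n) \<and> left_degree (G n) (D n) \<and>
        left (G n) \<noteq> {} \<and> int n = \<lceil>log 2 (real (card (left (G n))))\<rceil> \<and>
        (\<forall>x\<in>left (G n). length x = n)) \<and>
     (\<exists>Q (q :: nat poly) nb. \<forall>n\<in>I. \<forall>x\<in>left (G n).
        image_mset (nb n x) (mset_set {1..D n}) = neighbors (G n) x \<and>
        (\<forall>i\<in>{1..D n}. computes_within Q (Node (enc_bits x) (enc_nat i))
                         (enc_bits (nb n x i)) (poly q n)))"

text \<open>
  An algorithm for \<open>f\<close> receives the parameters of the graph and of the matching together with
  \<open>S\<close> and \<open>x\<close>. Since \<open>\<epsilon>\<close> is an arbitrary real number it is not itself an input; the algorithm gets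
  the number of edges \<open>l = \<lceil>(1 - 4 \<epsilon>) D\<rceil>\<close> (or \<open>0\<close>, if this is negative) that have to be assigned.
\<close>

definition matching_input ::
    "nat \<Rightarrow> nat \<Rightarrow> nat \<Rightarrow> nat \<Rightarrow> bool list list \<Rightarrow> bool list \<Rightarrow> tree" where
  "matching_input K D r l S x =
     Node (enc_nat K) (Node (enc_nat D) (Node (enc_nat r) (Node (enc_nat l)
       (Node (enc_list enc_bits S) (enc_bits x)))))"

text \<open>A multiset is output as a list of its elements, in any order.\<close>

definition computes_multiset_within :: "com \<Rightarrow> tree \<Rightarrow> bool list multiset \<Rightarrow> nat \<Rightarrow> bool" where
  "computes_multiset_within P input M T \<longleftrightarrow>
     (\<exists>ys. mset ys = M \<and> computes_within P input (enc_list enc_bits ys) T)"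

end

theory Submission
  imports Defs
begin

text \<open>
  The assignment is greedy on a sequence of levels. On each level a right node serves at most
  \<open>2 r\<close> left nodes; a left node joins the first level on which at least \<open>(1 - 4 \<epsilon>) D\<close> of its edges
  go to right nodes that are not yet full. If \<open>A\<close> is the set of nodes that reach some level,
  every full right node has at least \<open>2 r\<close> edges to \<open>A\<close>, so at least half of its edges are excess
  edges, and at most \<open>2 \<epsilon> D |A|\<close> edges lead from \<open>A\<close> to full nodes. Every node that is passed on
  accounts for more than \<open>4 \<epsilon> D\<close> of them, so fewer than \<open>|A| / 2\<close> nodes are passed on. Hence \<open>t\<close>
  nonempty levels need \<open>2\<^sup>t - 1 \<le> K\<close> nodes.

  For the algorithm, \<open>reach A m F g\<close> says that one program maps \<open>F i\<close> to \<open>g i\<close> for all instances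
  \<open>i \<in> A\<close> in time polynomial in \<open>m i\<close>. As \<open>g\<close> need only be given on the instances at hand, this
  relation is closed under composition, pairing, branching and loops of polynomial length without
  any condition on the size of intermediate results.
\<close>

subsection \<open>Polynomial-time reachability\<close>

text \<open>The 4 in \<open>4 * \<epsilon>\<close> is a product of two factors 2: one is lost by
  comparing all edges of a full node with its excess edges, the other buys the halving from level to
  level. Any smaller loss per node would still pass nodes on, but no longer at most half of them by
  this count.

  Two obstacles shape the program part. The time bound may not depend on \<open>r\<close>, so the
  comparison with \<open>2 * r\<close> has to end after the bits of the other operand. And an
  explicit family says nothing about the length of the names of right nodes, although loops run over
  these names; their length is recovered from the running time of the neighbour program by way of
  tree height.

  Copying a tree costs one unit however large it is, so only the number of rounds of a loop has to
  be controlled. This is why the lemmas about programs ask for bounds on list lengths and for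
  nothing else, and why every round of a loop is an instance \<open>(i, k)\<close> of its own, whose
  cost is measured by the size \<open>m i\<close> of the original instance.\<close>

fun uses_below :: "exp \<Rightarrow> nat \<Rightarrow> bool" where
  "uses_below (Var v) M = (v < M)"
| "uses_below ELeaf M = True"
| "uses_below (ENode a b) M = (uses_below a M \<and> uses_below b M)"
| "uses_below (EHd a) M = uses_below a M"
| "uses_below (ETl a) M = uses_below a M"

fun vars_below :: "com \<Rightarrow> nat \<Rightarrow> bool" where
  "vars_below Skip M = True"
| "vars_below (Assign v e) M = (v < M \<and> uses_below e M)"
| "vars_below (Seq c d) M = (vars_below c M \<and> vars_below d M)"
| "vars_below (If e c d) M = (uses_below e M \<and> vars_below c M \<and> vars_below d M)"
| "vars_below (While e c) M = (uses_below e M \<and> vars_below c M)"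

lemma uses_below_mono: "uses_below e M \<Longrightarrow> M \<le> N \<Longrightarrow> uses_below e N"
  by (induction e) auto

lemma vars_below_mono: "vars_below c M \<Longrightarrow> M \<le> N \<Longrightarrow> vars_below c N"
  by (induction c) (auto intro: uses_below_mono)

lemma ex_uses_below: "\<exists>M. uses_below e M"
proof (induction e)
  case (ENode a b)
  then obtain M N where "uses_below a M" "uses_below b N" by auto
  then have "uses_below (ENode a b) (max M N)" by (auto intro: uses_below_mono)
  then show ?case ..
qed auto

lemma ex_vars_below: "\<exists>M. vars_below c M"
proof (induction c)
  case (Assign v e)
  obtain M where "uses_below e M" using ex_uses_below by blast
  then have "vars_below (Assign v e) (max (Suc v) M)"
    by (auto intro: uses_below_mono)
  then show ?case ..
next
  case (Seq c d)
  then obtain M N where "vars_below c M" "vars_below d N" by auto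
  then have "vars_below (Seq c d) (max M N)" by (auto intro: vars_below_mono)
  then show ?case ..
next
  case (If e c d)
  then obtain M N where M: "vars_below c M" and N: "vars_below d N" by auto
  obtain L where L: "uses_below e L" using ex_uses_below by blast
  have "vars_below (If e c d) (max L (max M N))"
    using vars_below_mono[OF M] vars_below_mono[OF N] uses_below_mono[OF L] by simp
  then show ?case ..
next
  case (While e c)
  then obtain M where M: "vars_below c M" by auto
  obtain L where L: "uses_below e L" using ex_uses_below by blast
  have "vars_below (While e c) (max L M)"
    using vars_below_mono[OF M] uses_below_mono[OF L] by simp
  then show ?case ..
qed auto

lemma val_cong: "uses_below e M \<Longrightarrow> (\<And>v. v < M \<Longrightarrow> s v = u v) \<Longrightarrow> val e s = val e u"
  by (induction e) auto

definition overlay :: "nat \<Rightarrow> state \<Rightarrow> state \<Rightarrow> state" where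
  "overlay M s u = (\<lambda>v. if v < M then s v else u v)"

lemma val_overlay: "uses_below e M \<Longrightarrow> val e (overlay M s u) = val e s"
  by (rule val_cong) (auto simp: overlay_def)

text \<open>A program neither reads nor writes variables that it does not mention, so the same run
  takes place, in the same time, above arbitrary saved data. This makes the high variables safe
  storage around a subprogram.\<close>

lemma exec_overlay:
  "exec c s t s' \<Longrightarrow> vars_below c M \<Longrightarrow> exec c (overlay M s u) t (overlay M s' u)"
proof (induction rule: exec.induct)
  case (Assign v e s)
  have "overlay M (s(v := val e s)) u = (overlay M s u)(v := val e (overlay M s u))"
    using Assign by (auto simp: overlay_def val_overlay[unfolded overlay_def])
  then show ?case by (simp only: exec.Assign)
next
  case (Skip s)
  show ?case by (rule exec.Skip)
next
  case (Seq c1 s1 t1 s2 c2 t2 s3)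
  then show ?case by (intro exec.Seq) auto
next
  case (IfTrue e s c1 t s' c2)
  then show ?case by (intro exec.IfTrue) (auto simp: val_overlay)
next
  case (IfFalse e s c2 t s' c1)
  then show ?case by (intro exec.IfFalse) (auto simp: val_overlay)
next
  case (WhileFalse e s c)
  then show ?case by (intro exec.WhileFalse) (auto simp: val_overlay)
next
  case (WhileTrue e s1 c t1 s2 t2 s3)
  then show ?case by (intro exec.WhileTrue) (auto simp: val_overlay)
qed

fun clear :: "nat \<Rightarrow> com" where
  "clear 0 = Skip"
| "clear (Suc M) = Seq (clear M) (Assign (Suc M) ELeaf)"

lemma exec_clear:
  "exec (clear M) s (1 + 2 * M) (\<lambda>v. if 0 < v \<and> v \<le> M then Leaf else s v)"
proof (induction M)
  case 0
  have "(\<lambda>v::nat. if 0 < v \<and> v \<le> 0 then Leaf else s v) = s" by auto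
  then show ?case using exec.Skip[of s] by simp
next
  case (Suc M)
  have "(\<lambda>v. if 0 < v \<and> v \<le> M then Leaf else s v)(Suc M := Leaf)
      = (\<lambda>v. if 0 < v \<and> v \<le> Suc M then Leaf else s v)" by auto
  then show ?case
    using exec.Seq[OF Suc exec.Assign[of "Suc M" ELeaf]] by simp
qed

definition reach ::
    "'i set \<Rightarrow> ('i \<Rightarrow> nat) \<Rightarrow> ('i \<Rightarrow> tree) \<Rightarrow> ('i \<Rightarrow> tree) \<Rightarrow> bool" where
  "reach A m F g \<longleftrightarrow>
     (\<exists>P (q :: nat poly). \<forall>i\<in>A. computes_within P (F i) (g i) (poly q (m i)))"

text \<open>A tidy program leaves no garbage and ignores the variables from \<open>M\<close> on, so that
  tidy programs can be composed freely.\<close>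

definition tidy ::
    "com \<Rightarrow> nat \<Rightarrow> nat poly \<Rightarrow> 'i set \<Rightarrow> ('i \<Rightarrow> nat) \<Rightarrow> ('i \<Rightarrow> tree) \<Rightarrow> ('i \<Rightarrow> tree) \<Rightarrow> bool" where
  "tidy P M q A m F g \<longleftrightarrow> 0 < M \<and>
     (\<forall>i\<in>A. \<forall>s. s 0 = F i \<and> (\<forall>v. 0 < v \<and> v < M \<longrightarrow> s v = Leaf) \<longrightarrow>
        (\<exists>t \<le> poly q (m i). exec P s t (s(0 := g i))))"

lemma tidyD:
  assumes "tidy P M q A m F g" "i \<in> A" "s 0 = F i" "\<And>v. 0 < v \<Longrightarrow> v < M \<Longrightarrow> s v = Leaf"
    and "s' = s(0 := g i)"
  obtains t where "t \<le> poly q (m i)" "exec P s t s'"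
  using assms unfolding tidy_def by blast

lemma tidy_mono: "tidy P M q A m F g \<Longrightarrow> M \<le> N \<Longrightarrow> tidy P N q A m F g"
  unfolding tidy_def by auto

lemma tidy_imp_reach: "tidy P M q A m F g \<Longrightarrow> reach A m F g"
  unfolding reach_def computes_within_def
proof (intro exI[of _ P] exI[of _ q] ballI)
  fix i assume P: "tidy P M q A m F g" and i: "i \<in> A"
  let ?s = "(\<lambda>_. Leaf)(0 := F i)"
  obtain t where "t \<le> poly q (m i)" "exec P ?s t (?s(0 := g i))"
    by (rule tidyD[OF P i, of ?s "?s(0 := g i)"]) auto
  moreover have "(?s(0 := g i)) 0 = g i" by simp
  ultimately show "\<exists>t s. t \<le> poly q (m i) \<and> exec P ?s t s \<and> s 0 = g i" by blast
qed

text \<open>By the frame property, the run from the blank state can be repeated in every state that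
  is blank below \<open>M\<close>; wiping the work variables afterwards costs a constant.\<close>

lemma reach_imp_tidy:
  assumes "reach A m F g"
  obtains P M q where "tidy P M q A m F g"
proof -
  obtain P q where P: "\<And>i. i \<in> A \<Longrightarrow> computes_within P (F i) (g i) (poly q (m i))"
    using assms unfolding reach_def by blast
  obtain N where "vars_below P N" using ex_vars_below by blast
  \<comment> \<open>\<open>Suc N\<close> is positive even for a program without variables, and it
    matches \<open>clear N\<close>, which resets the variables 1 to \<open>N\<close>.\<close>
  define M where "M = Suc N"
  have M: "vars_below P M"
    unfolding M_def by (rule vars_below_mono[OF \<open>vars_below P N\<close>]) simp
  have "tidy (Seq P (clear N)) M (q + [:1 + 2 * N:]) A m F g"
    unfolding tidy_def
  proof (intro conjI ballI allI impI)
    show "0 < M" by (simp add: M_def)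
    fix i s assume i: "i \<in> A" and s: "s 0 = F i \<and> (\<forall>v. 0 < v \<and> v < M \<longrightarrow> s v = Leaf)"
    obtain t s' where t: "t \<le> poly q (m i)" and s': "s' 0 = g i"
      and ex: "exec P ((\<lambda>_. Leaf)(0 := F i)) t s'"
      using P[OF i] unfolding computes_within_def by blast
    have "overlay M ((\<lambda>_. Leaf)(0 := F i)) s = s"
      using s by (auto simp: overlay_def)
    with exec_overlay[OF ex M, of s] have ex': "exec P s t (overlay M s' s)" by simp
    have "(\<lambda>v. if 0 < v \<and> v \<le> N then Leaf else overlay M s' s v) = s(0 := g i)"
      using s s' by (auto simp: overlay_def M_def)
    with exec.Seq[OF ex' exec_clear[of N]]
    have "exec (Seq P (clear N)) s (t + (1 + 2 * N)) (s(0 := g i))" by simp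
    moreover have "t + (1 + 2 * N) \<le> poly (q + [:1 + 2 * N:]) (m i)" using t by simp
    ultimately show "\<exists>t\<le>poly (q + [:1 + 2 * N:]) (m i). exec (Seq P (clear N)) s t (s(0 := g i))"
      by blast
  qed
  then show ?thesis by (rule that)
qed

section \<open>Closure properties of polynomial-time reachability\<close>

lemma reach_cong:
  assumes "reach A m F g" "\<And>i. i \<in> A \<Longrightarrow> g i = h i"
  shows "reach A m F h"
  using assms unfolding reach_def by (metis (no_types, lifting))

lemma reach_mono:
  assumes "reach A m F g" "B \<subseteq> A"
  shows "reach B m F g"
  using assms unfolding reach_def by (meson subsetD)

lemma poly_nat_mono: "x \<le> y \<Longrightarrow> poly p x \<le> poly (p :: nat poly) y"
  by (induction p) (auto intro!: add_mono mult_mono)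

text \<open>The same program serves every family of instances that maps into \<open>A\<close>. This
  carries facts about the input over to the rounds of a loop on it.\<close>

lemma reach_reindex:
  assumes "reach A m F g" "\<And>j. j \<in> B \<Longrightarrow> h j \<in> A" "\<And>j. j \<in> B \<Longrightarrow> m (h j) \<le> m' j"
  shows "reach B m' (\<lambda>j. F (h j)) (\<lambda>j. g (h j))"
  using assms unfolding reach_def computes_within_def
  by (meson le_trans poly_nat_mono)

text \<open>Polynomials are closed under composition. A measure may therefore be enlarged
  polynomially, until it bounds all list lengths that occur on the way.\<close>

lemma reach_poly:
  assumes "reach A (\<lambda>i. poly p (m i)) F g"
  shows "reach A m F g"
  using assms unfolding reach_def by (metis poly_pcompose)

lemma reach_val: "reach A m F (\<lambda>i. val e ((\<lambda>_. Leaf)(0 := F i)))"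
  unfolding reach_def computes_within_def
proof (intro exI[of _ "Assign 0 e"] exI[of _ "[:1 + cost e:]"] ballI)
  fix i
  show "\<exists>t s. t \<le> poly [:1 + cost e:] (m i) \<and> exec (Assign 0 e) ((\<lambda>_. Leaf)(0 := F i)) t s \<and>
      s 0 = val e ((\<lambda>_. Leaf)(0 := F i))"
    by (rule exI[of _ "1 + cost e"], rule exI, intro conjI, simp, rule exec.Assign, simp)
qed

lemma reach_id: "reach A m F F"
  using reach_val[of A m F "Var 0"] by simp

text \<open>Both time bounds are stated in \<open>m i\<close>, the second one not in the size of
  \<open>g i\<close>. The polynomials simply add up, and the intermediate result may be of any
  size.\<close>

lemma reach_comp:
  assumes "reach A m F g" "reach A m g h"
  shows "reach A m F h"
proof -
  obtain P M p where P0: "tidy P M p A m F g" using assms(1) by (rule reach_imp_tidy)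
  obtain Q N q where Q0: "tidy Q N q A m g h" using assms(2) by (rule reach_imp_tidy)
  define L where "L = max M N"
  have P: "tidy P L p A m F g" and Q: "tidy Q L q A m g h"
    using P0 Q0 by (auto simp: L_def intro: tidy_mono)
  have "tidy (Seq P Q) L (p + q) A m F h"
    unfolding tidy_def
  proof (intro conjI ballI allI impI)
    show "0 < L" using P by (simp add: tidy_def)
    fix i s assume i: "i \<in> A" and s: "s 0 = F i \<and> (\<forall>v. 0 < v \<and> v < L \<longrightarrow> s v = Leaf)"
    obtain t where t: "t \<le> poly p (m i)" "exec P s t (s(0 := g i))"
      by (rule tidyD[OF P i, of s "s(0 := g i)"]) (use s in auto)
    obtain t' where t': "t' \<le> poly q (m i)" "exec Q (s(0 := g i)) t' (s(0 := h i))"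
      by (rule tidyD[OF Q i, of "s(0 := g i)" "s(0 := h i)"]) (use s in auto)
    show "\<exists>t\<le>poly (p + q) (m i). exec (Seq P Q) s t (s(0 := h i))"
      using exec.Seq[OF t(2) t'(2)] add_mono[OF t(1) t'(1)] by auto
  qed
  then show ?thesis by (rule tidy_imp_reach)
qed

lemma reach_Leaf: "reach A m F (\<lambda>i. Leaf)"
  using reach_val[of A m F ELeaf] by simp

lemma reach_head: "reach A m F g \<Longrightarrow> reach A m F (\<lambda>i. head (g i))"
  by (erule reach_comp) (use reach_val[of A m g "EHd (Var 0)"] in simp)

lemma reach_tail: "reach A m F g \<Longrightarrow> reach A m F (\<lambda>i. tail (g i))"
  by (erule reach_comp) (use reach_val[of A m g "ETl (Var 0)"] in simp)

lemma reach_NodeD1: "reach A m F (\<lambda>i. Node (g i) (h i)) \<Longrightarrow> reach A m F g"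
  by (drule reach_head) simp

lemma reach_NodeD2: "reach A m F (\<lambda>i. Node (g i) (h i)) \<Longrightarrow> reach A m F h"
  by (drule reach_tail) simp

lemma reach_Node:
  assumes "reach A m F g" "reach A m F h"
  shows "reach A m F (\<lambda>i. Node (g i) (h i))"
proof -
  obtain P M p where P0: "tidy P M p A m F g" using assms(1) by (rule reach_imp_tidy)
  obtain Q N q where Q0: "tidy Q N q A m F h" using assms(2) by (rule reach_imp_tidy)
  define L where "L = max M N"
  have P: "tidy P L p A m F g" and Q: "tidy Q L q A m F h"
    using P0 Q0 by (auto simp: L_def intro: tidy_mono)
  have L0: "0 < L" using P by (simp add: tidy_def)
  \<comment> \<open>\<open>L\<close> keeps the input while \<open>P\<close> runs, and
    \<open>Suc L\<close> keeps the result of \<open>P\<close> while \<open>Q\<close> runs. The six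
    assignments cost 2 + 2 + 2 + 4 + 2 + 2 = 14 units.\<close>
  let ?R = "Seq (Assign L (Var 0)) (Seq P (Seq (Assign (Suc L) (Var 0)) (Seq (Assign 0 (Var L))
    (Seq Q (Seq (Assign 0 (ENode (Var (Suc L)) (Var 0)))
      (Seq (Assign L ELeaf) (Assign (Suc L) ELeaf)))))))"
  have "tidy ?R (Suc (Suc L)) (p + q + [:14:]) A m F (\<lambda>i. Node (g i) (h i))"
    unfolding tidy_def
  proof (intro conjI ballI allI impI)
    show "0 < Suc (Suc L)" by simp
    fix i s assume i: "i \<in> A"
      and s: "s 0 = F i \<and> (\<forall>v. 0 < v \<and> v < Suc (Suc L) \<longrightarrow> s v = Leaf)"
    define s1 where "s1 = s(L := F i)"
    have 1: "exec (Assign L (Var 0)) s 2 s1"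
      using exec.Assign[of L "Var 0" s] s by (simp add: s1_def numeral_2_eq_2)
    define s2 where "s2 = s1(0 := g i)"
    obtain t where t: "t \<le> poly p (m i)" "exec P s1 t s2"
      by (rule tidyD[OF P i, of s1 s2]) (use s L0 in \<open>auto simp: s1_def s2_def\<close>)
    define s3 where "s3 = s2(Suc L := g i)"
    have 3: "exec (Assign (Suc L) (Var 0)) s2 2 s3"
      using exec.Assign[of "Suc L" "Var 0" s2] by (simp add: s2_def s3_def numeral_2_eq_2)
    define s4 where "s4 = s3(0 := F i)"
    have 4: "exec (Assign 0 (Var L)) s3 2 s4"
      using exec.Assign[of 0 "Var L" s3] L0 by (simp add: s4_def s3_def s2_def s1_def numeral_2_eq_2)
    define s5 where "s5 = s4(0 := h i)"
    obtain t' where t': "t' \<le> poly q (m i)" "exec Q s4 t' s5"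
      by (rule tidyD[OF Q i, of s4 s5])
        (use s L0 in \<open>auto simp: s1_def s2_def s3_def s4_def s5_def\<close>)
    define s6 where "s6 = s5(0 := Node (g i) (h i))"
    have 6: "exec (Assign 0 (ENode (Var (Suc L)) (Var 0))) s5 4 s6"
      using exec.Assign[of 0 "ENode (Var (Suc L)) (Var 0)" s5]
      by (simp add: s6_def s5_def s4_def s3_def eval_nat_numeral)
    define s7 where "s7 = s6(L := Leaf)"
    have 7: "exec (Assign L ELeaf) s6 2 s7"
      using exec.Assign[of L ELeaf s6] by (simp add: s7_def numeral_2_eq_2)
    have "s7(Suc L := Leaf) = s(0 := Node (g i) (h i))"
      using s L0 by (auto simp: s1_def s2_def s3_def s4_def s5_def s6_def s7_def)
    then have 8: "exec (Assign (Suc L) ELeaf) s7 2 (s(0 := Node (g i) (h i)))"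
      using exec.Assign[of "Suc L" ELeaf s7] by (simp add: numeral_2_eq_2)
    have "exec ?R s (2 + (t + (2 + (2 + (t' + (4 + (2 + 2))))))) (s(0 := Node (g i) (h i)))"
      by (intro exec.Seq[OF 1] exec.Seq[OF t(2)] exec.Seq[OF 3] exec.Seq[OF 4]
          exec.Seq[OF t'(2)] exec.Seq[OF 6] exec.Seq[OF 7] 8)
    moreover have "2 + (t + (2 + (2 + (t' + (4 + (2 + 2)))))) \<le> poly (p + q + [:14:]) (m i)"
      using t t' by simp
    ultimately show "\<exists>t\<le>poly (p + q + [:14:]) (m i). exec ?R s t (s(0 := Node (g i) (h i)))"
      by blast
  qed
  then show ?thesis by (rule tidy_imp_reach)
qed

text \<open>The test value is put in front of the input and stripped by the chosen branch. A branch
  has to be correct only on the instances that enter it, so its code may rely on the outcome of the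
  test.\<close>

lemma reach_cases:
  assumes b: "reach A m F b"
    and g: "reach {i\<in>A. b i \<noteq> Leaf} m F g"
    and h: "reach {i\<in>A. b i = Leaf} m F g"
  shows "reach A m F g"
proof -
  let ?B = "{i\<in>A. b i \<noteq> Leaf}" and ?C = "{i\<in>A. b i = Leaf}"
  have "reach ?B m (\<lambda>i. Node (b i) (F i)) g"
    by (rule reach_comp[OF reach_NodeD2[OF reach_id] g])
  then obtain P M p where P0: "tidy P M p ?B m (\<lambda>i. Node (b i) (F i)) g"
    by (rule reach_imp_tidy)
  have "reach ?C m (\<lambda>i. Node (b i) (F i)) g"
    by (rule reach_comp[OF reach_NodeD2[OF reach_id] h])
  then obtain Q N q where Q0: "tidy Q N q ?C m (\<lambda>i. Node (b i) (F i)) g"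
    by (rule reach_imp_tidy)
  define L where "L = max M N"
  have P: "tidy P L p ?B m (\<lambda>i. Node (b i) (F i)) g"
    and Q: "tidy Q L q ?C m (\<lambda>i. Node (b i) (F i)) g"
    using P0 Q0 by (auto simp: L_def intro: tidy_mono)
  let ?R = "If (EHd (Var 0)) P Q"
  have "tidy ?R L (p + q + [:3:]) A m (\<lambda>i. Node (b i) (F i)) g"
    unfolding tidy_def
  proof (intro conjI ballI allI impI)
    show "0 < L" using P by (simp add: tidy_def)
    fix i s assume i: "i \<in> A"
      and s: "s 0 = Node (b i) (F i) \<and> (\<forall>v. 0 < v \<and> v < L \<longrightarrow> s v = Leaf)"
    show "\<exists>t\<le>poly (p + q + [:3:]) (m i). exec ?R s t (s(0 := g i))"
    proof (cases "b i = Leaf")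
      case True
      obtain t where t: "t \<le> poly q (m i)" "exec Q s t (s(0 := g i))"
        by (rule tidyD[OF Q, of i s "s(0 := g i)"]) (use s i True in auto)
      have "exec ?R s (1 + cost (EHd (Var 0)) + t) (s(0 := g i))"
        by (rule exec.IfFalse[OF _ t(2)]) (use s True in auto)
      then show ?thesis using t by (intro exI[of _ "3 + t"]) (auto simp: numeral_3_eq_3)
    next
      case False
      obtain t where t: "t \<le> poly p (m i)" "exec P s t (s(0 := g i))"
        by (rule tidyD[OF P, of i s "s(0 := g i)"]) (use s i False in auto)
      have "exec ?R s (1 + cost (EHd (Var 0)) + t) (s(0 := g i))"
        by (rule exec.IfTrue[OF _ t(2)]) (use s False in auto)
      then show ?thesis using t by (intro exI[of _ "3 + t"]) (auto simp: numeral_3_eq_3)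
    qed
  qed
  then have "reach A m (\<lambda>i. Node (b i) (F i)) g" by (rule tidy_imp_reach)
  then show ?thesis by (rule reach_comp[OF reach_Node[OF b reach_id]])
qed

lemma reach_if:
  assumes "reach A m F b" "\<And>i. i \<in> A \<Longrightarrow> b i \<noteq> Leaf \<longleftrightarrow> P i"
    and "reach {i\<in>A. P i} m F g"
    and "reach {i\<in>A. \<not> P i} m F h"
  shows "reach A m F (\<lambda>i. if P i then g i else h i)"
proof (rule reach_cases[OF assms(1)])
  have "{i\<in>A. b i \<noteq> Leaf} = {i\<in>A. P i}" using assms(2) by auto
  then show "reach {i\<in>A. b i \<noteq> Leaf} m F (\<lambda>i. if P i then g i else h i)"
    using reach_cong[OF assms(3), of "\<lambda>i. if P i then g i else h i"] by simp
  have "{i\<in>A. b i = Leaf} = {i\<in>A. \<not> P i}" using assms(2) by auto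
  then show "reach {i\<in>A. b i = Leaf} m F (\<lambda>i. if P i then g i else h i)"
    using reach_cong[OF assms(4), of "\<lambda>i. if P i then g i else h i"] by simp
qed

text \<open>One program performs every round, and its time is bounded in terms of \<open>m i\<close>
  alone, independently of \<open>k\<close> and of the size of \<open>g i k\<close>. With at most
  \<open>m i\<close> rounds the total stays polynomial.\<close>

lemma reach_while:
  assumes start: "reach A m F (\<lambda>i. g i 0)"
    and N: "\<And>i. i \<in> A \<Longrightarrow> N i \<le> m i"
    and continue: "\<And>i k. i \<in> A \<Longrightarrow> k < N i \<Longrightarrow> head (g i k) \<noteq> Leaf"
    and stop: "\<And>i. i \<in> A \<Longrightarrow> head (g i (N i)) = Leaf"
    and step: "reach {(i, k). i \<in> A \<and> k < N i} (\<lambda>j. m (fst j))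
      (\<lambda>j. g (fst j) (snd j)) (\<lambda>j. g (fst j) (Suc (snd j)))"
  shows "reach A m F (\<lambda>i. g i (N i))"
proof (rule reach_comp[OF start])
  obtain P M p where P: "tidy P M p {(i, k). i \<in> A \<and> k < N i} (\<lambda>j. m (fst j))
      (\<lambda>j. g (fst j) (snd j)) (\<lambda>j. g (fst j) (Suc (snd j)))"
    using step by (rule reach_imp_tidy)
  let ?R = "While (EHd (Var 0)) P"
  have M: "0 < M" using P by (simp add: tidy_def)
  \<comment> \<open>Induction on the number \<open>d\<close> of rounds still to come. Each test
    costs 3 units; the summand 3 in front pays for the last one, which fails.\<close>
  have loop: "\<exists>t \<le> 3 + d * (poly p (m i) + 3). exec ?R (s(0 := g i k)) t (s(0 := g i (N i)))"
    if "i \<in> A" "\<And>v. 0 < v \<Longrightarrow> v < M \<Longrightarrow> s v = Leaf" "k + d = N i" for i s d k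
    using that
  proof (induction d arbitrary: k)
    case 0
    then show ?case
      using exec.WhileFalse[of "EHd (Var 0)" "s(0 := g i (N i))" P] stop[of i]
      by (intro exI[of _ 3]) (simp add: numeral_3_eq_3 del: fun_upd_apply, simp)
  next
    case (Suc d)
    obtain t where t: "t \<le> poly p (m i)" "exec P (s(0 := g i k)) t (s(0 := g i (Suc k)))"
      by (rule tidyD[OF P, of "(i, k)" "s(0 := g i k)" "s(0 := g i (Suc k))"])
        (use Suc.prems in auto)
    obtain t' where t': "t' \<le> 3 + d * (poly p (m i) + 3)"
      "exec ?R (s(0 := g i (Suc k))) t' (s(0 := g i (N i)))"
      using Suc.IH[of "Suc k"] Suc.prems by (auto simp del: fun_upd_apply)
    have "exec ?R (s(0 := g i k)) (1 + cost (EHd (Var 0)) + t + t') (s(0 := g i (N i)))"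
      by (rule exec.WhileTrue[OF _ t(2) t'(2)]) (use continue[of i k] Suc.prems in auto)
    moreover have "1 + cost (EHd (Var 0)) + t + t' \<le> 3 + Suc d * (poly p (m i) + 3)"
      using t(1) t'(1) by simp
    ultimately show ?case by blast
  qed
  have "tidy ?R M ([:3:] + [:0, 1:] * (p + [:3:])) A m (\<lambda>i. g i 0) (\<lambda>i. g i (N i))"
    unfolding tidy_def
  proof (intro conjI ballI allI impI M)
    fix i s assume i: "i \<in> A" and s: "s 0 = g i 0 \<and> (\<forall>v. 0 < v \<and> v < M \<longrightarrow> s v = Leaf)"
    have "s(0 := g i 0) = s" using s by auto
    then obtain t where t: "t \<le> 3 + N i * (poly p (m i) + 3)" "exec ?R s t (s(0 := g i (N i)))"
      using loop[of i s 0 "N i"] i s by auto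
    have "t \<le> 3 + m i * (poly p (m i) + 3)"
      using t(1) N[OF i] by (meson add_left_mono le_trans mult_le_mono1)
    then show "\<exists>t\<le>poly ([:3:] + [:0, 1:] * (p + [:3:])) (m i). exec ?R s t (s(0 := g i (N i)))"
      using t(2) by (intro exI[of _ t]) simp
  qed
  then show "reach A m (\<lambda>i. g i 0) (\<lambda>i. g i (N i))" by (rule tidy_imp_reach)
qed

text \<open>The loop carries the whole input \<open>F i\<close> along, so its body may use everything that is
  computable from the input.\<close>

lemma reach_iterate:
  fixes acc :: "'i \<Rightarrow> nat \<Rightarrow> tree"
  assumes N: "\<And>i. i \<in> A \<Longrightarrow> N i \<le> m i"
    and start: "reach A m F (\<lambda>i. acc i 0)"
    and test: "\<And>F'. (\<And>g. reach A m F g \<Longrightarrow>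
          reach {(i, k). i \<in> A \<and> k \<le> N i} (\<lambda>j. m (fst j)) F' (\<lambda>j. g (fst j))) \<Longrightarrow>
        reach {(i, k). i \<in> A \<and> k \<le> N i} (\<lambda>j. m (fst j)) F' (\<lambda>j. acc (fst j) (snd j)) \<Longrightarrow>
        reach {(i, k). i \<in> A \<and> k \<le> N i} (\<lambda>j. m (fst j)) F'
          (\<lambda>j. b (fst j) (snd j))"
    and b: "\<And>i k. i \<in> A \<Longrightarrow> k \<le> N i \<Longrightarrow> b i k = Leaf \<longleftrightarrow> k = N i"
    and step: "\<And>F'. (\<And>g. reach A m F g \<Longrightarrow>
          reach {(i, k). i \<in> A \<and> k < N i} (\<lambda>j. m (fst j)) F' (\<lambda>j. g (fst j))) \<Longrightarrow>
        reach {(i, k). i \<in> A \<and> k < N i} (\<lambda>j. m (fst j)) F' (\<lambda>j. acc (fst j) (snd j)) \<Longrightarrow>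
        reach {(i, k). i \<in> A \<and> k < N i} (\<lambda>j. m (fst j)) F' (\<lambda>j. acc (fst j) (Suc (snd j)))"
  shows "reach A m F (\<lambda>i. acc i (N i))"
proof -
  let ?m = "\<lambda>j. m (fst j)"
  let ?A = "{(i, k). i \<in> A \<and> k < N i}" and ?A' = "{(i, k). i \<in> A \<and> k \<le> N i}"
  \<comment> \<open>\<open>G\<close> is the input beside the accumulator. \<open>g\<close> puts the
    test value in front, since \<open>reach_while\<close> inspects the head of the loop
    state.\<close>
  define G where "G i k = Node (F i) (acc i k)" for i k
  define g where "g i k = Node (b i k) (G i k)" for i k
  have weaken: "reach B ?m F' (\<lambda>j. h (fst j))"
    if "reach B ?m F' (\<lambda>j. F (fst j))" "\<And>i k. (i, k) \<in> B \<Longrightarrow> i \<in> A" "reach A m F h"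
    for B :: "('i \<times> nat) set" and F' h
    by (rule reach_comp[OF that(1) reach_reindex[OF that(3)]]) (use that(2) in auto)
  \<comment> \<open>The test is evaluated before the first round and again after each round, so its
    instances include \<open>k = N i\<close>, which those of the step do not.\<close>
  have G: "reach ?A' ?m (\<lambda>j. G (fst j) (snd j)) (\<lambda>j. b (fst j) (snd j))"
    unfolding G_def
    by (rule test, rule weaken) (auto intro: reach_NodeD1[OF reach_id] reach_NodeD2[OF reach_id])
  have G0: "reach A m (\<lambda>i. G i 0) (\<lambda>i. b i 0)"
    using reach_reindex[OF G, of A "\<lambda>i. (i, 0)" m] by simp
  have start': "reach A m F (\<lambda>i. g i 0)"
  proof -
    have 1: "reach A m F (\<lambda>i. G i 0)"
      unfolding G_def by (rule reach_Node[OF reach_id start])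
    show ?thesis unfolding g_def
      by (rule reach_Node[OF reach_comp[OF 1 G0] 1])
  qed
  have gF: "reach ?A ?m (\<lambda>j. g (fst j) (snd j)) (\<lambda>j. F (fst j))"
    and gacc: "reach ?A ?m (\<lambda>j. g (fst j) (snd j)) (\<lambda>j. acc (fst j) (snd j))"
    unfolding g_def G_def
    by (rule reach_NodeD1[OF reach_NodeD2[OF reach_id]] reach_NodeD2[OF reach_NodeD2[OF reach_id]])+
  have gstep: "reach ?A ?m (\<lambda>j. g (fst j) (snd j)) (\<lambda>j. acc (fst j) (Suc (snd j)))"
    by (rule step, rule weaken[OF gF]) (auto intro: gacc)
  have gG: "reach ?A ?m (\<lambda>j. g (fst j) (snd j)) (\<lambda>j. G (fst j) (Suc (snd j)))"
    unfolding G_def by (rule reach_Node[OF gF gstep])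
  have "reach ?A ?m (\<lambda>j. G (fst j) (Suc (snd j))) (\<lambda>j. b (fst j) (Suc (snd j)))"
    using reach_reindex[OF G, of ?A "\<lambda>j. (fst j, Suc (snd j))" ?m] by auto
  then have "reach ?A ?m (\<lambda>j. g (fst j) (snd j)) (\<lambda>j. g (fst j) (Suc (snd j)))"
    unfolding g_def by (intro reach_Node gG[unfolded g_def] reach_comp[OF gG[unfolded g_def]])
  then have "reach A m F (\<lambda>i. g i (N i))"
    by (intro reach_while[where g = g and N = N] start' N) (auto simp: g_def b)
  then have "reach A m F (\<lambda>i. Node (b i (N i)) (Node (F i) (acc i (N i))))"
    by (simp add: g_def G_def)
  then show ?thesis by (rule reach_NodeD2[OF reach_NodeD2])
qed

lemma tail_enc_list: "tail (enc_list enc xs) = enc_list enc (tl xs)"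
  by (cases xs) auto

lemma enc_list_eq_Leaf [simp]: "enc_list enc xs = Leaf \<longleftrightarrow> xs = []"
  by (cases xs) auto

text \<open>The unread rest of the list travels beside the accumulator and serves as the loop test.
  \<open>acc i k\<close> specifies the value after \<open>k\<close> elements and need not come from
  a folded operation, so it may refer to the whole instance.\<close>

lemma reach_fold:
  fixes acc :: "'i \<Rightarrow> nat \<Rightarrow> tree"
  assumes xs: "reach A m F (\<lambda>i. enc_list enc (xs i))"
    and N: "\<And>i. i \<in> A \<Longrightarrow> length (xs i) \<le> m i"
    and start: "reach A m F (\<lambda>i. acc i 0)"
    and step: "\<And>F'. (\<And>g. reach A m F g \<Longrightarrow>
          reach {(i, k). i \<in> A \<and> k < length (xs i)} (\<lambda>j. m (fst j)) F' (\<lambda>j. g (fst j))) \<Longrightarrow>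
        reach {(i, k). i \<in> A \<and> k < length (xs i)} (\<lambda>j. m (fst j)) F'
          (\<lambda>j. enc (xs (fst j) ! snd j)) \<Longrightarrow>
        reach {(i, k). i \<in> A \<and> k < length (xs i)} (\<lambda>j. m (fst j)) F'
          (\<lambda>j. acc (fst j) (snd j)) \<Longrightarrow>
        reach {(i, k). i \<in> A \<and> k < length (xs i)} (\<lambda>j. m (fst j)) F'
          (\<lambda>j. acc (fst j) (Suc (snd j)))"
  shows "reach A m F (\<lambda>i. acc i (length (xs i)))"
proof -
  let ?acc = "\<lambda>i k. Node (enc_list enc (drop k (xs i))) (acc i k)"
  have "reach A m F (\<lambda>i. ?acc i (length (xs i)))"
  proof (rule reach_iterate[where N = "\<lambda>i. length (xs i)"
        and b = "\<lambda>i k. enc_list enc (drop k (xs i))"])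
    show "reach A m F (\<lambda>i. ?acc i 0)" using reach_Node[OF xs start] by simp
  next
    fix F'
    let ?r = "reach {(i, k). i \<in> A \<and> k < length (xs i)} (\<lambda>j. m (fst j)) F'"
    assume env: "\<And>g. reach A m F g \<Longrightarrow> ?r (\<lambda>j. g (fst j))"
      and acc: "?r (\<lambda>j. ?acc (fst j) (snd j))"
    have d: "?r (\<lambda>j. enc_list enc (drop (snd j) (xs (fst j))))"
      by (rule reach_NodeD1[OF acc])
    have "?r (\<lambda>j. enc_list enc (drop (Suc (snd j)) (xs (fst j))))"
      using reach_tail[OF d] by (simp add: tail_enc_list drop_Suc tl_drop)
    moreover have "?r (\<lambda>j. enc (xs (fst j) ! snd j))"
      by (rule reach_cong[OF reach_head[OF d]]) (auto simp flip: Cons_nth_drop_Suc)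
    ultimately show "?r (\<lambda>j. ?acc (fst j) (Suc (snd j)))"
      by (intro reach_Node step env reach_NodeD2[OF acc])
  next
    fix F'
    let ?r = "reach {(i, k). i \<in> A \<and> k \<le> length (xs i)} (\<lambda>j. m (fst j)) F'"
    assume "?r (\<lambda>j. ?acc (fst j) (snd j))"
    then show "?r (\<lambda>j. enc_list enc (drop (snd j) (xs (fst j))))"
      by (rule reach_NodeD1)
  qed (auto simp: N)
  then show ?thesis by (rule reach_NodeD2)
qed

subsection \<open>Lists and binary numbers\<close>

lemma reach_const: "reach A m F (\<lambda>i. t)"
  by (induction t) (auto intro: reach_Leaf reach_Node)

lemma enc_bool_eq_Leaf [simp]: "enc_bool b = Leaf \<longleftrightarrow> \<not> b"
  by (simp add: enc_bool_def)

lemma reach_test: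
  assumes "reach A m F b" "\<And>i. i \<in> A \<Longrightarrow> b i \<noteq> Leaf \<longleftrightarrow> P i"
  shows "reach A m F (\<lambda>i. enc_bool (P i))"
  by (rule reach_cong[OF reach_if[OF assms reach_const reach_const,
          of "enc_bool True" "enc_bool False"]]) (auto simp: enc_bool_def)

lemma reach_not:
  assumes "reach A m F (\<lambda>i. enc_bool (P i))"
  shows "reach A m F (\<lambda>i. enc_bool (\<not> P i))"
  by (rule reach_cong[OF reach_if[OF assms _ reach_const reach_const,
          of P "enc_bool False" "enc_bool True"]]) (auto simp: enc_bool_def)

lemma reach_conj:
  assumes "reach A m F (\<lambda>i. enc_bool (P i))" "reach A m F (\<lambda>i. enc_bool (Q i))"
  shows "reach A m F (\<lambda>i. enc_bool (P i \<and> Q i))"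
  by (rule reach_cong[OF reach_if[OF assms(1) _ reach_mono[OF assms(2)] reach_const,
          of P "enc_bool False"]]) (auto simp: enc_bool_def)

lemma reach_disj:
  assumes "reach A m F (\<lambda>i. enc_bool (P i))" "reach A m F (\<lambda>i. enc_bool (Q i))"
  shows "reach A m F (\<lambda>i. enc_bool (P i \<or> Q i))"
  using reach_not[OF reach_conj[OF reach_not[OF assms(1)] reach_not[OF assms(2)]]] by simp

lemma reach_iff:
  assumes "reach A m F (\<lambda>i. enc_bool (P i))" "reach A m F (\<lambda>i. enc_bool (Q i))"
  shows "reach A m F (\<lambda>i. enc_bool (P i \<longleftrightarrow> Q i))"
  using reach_conj[OF reach_disj[OF reach_not[OF assms(1)] assms(2)]
      reach_disj[OF reach_not[OF assms(2)] assms(1)]]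
  by (rule reach_cong) (auto simp: enc_bool_def)

lemma reach_nonempty:
  "reach A m F (\<lambda>i. enc_list enc (xs i)) \<Longrightarrow> reach A m F (\<lambda>i. enc_bool (xs i \<noteq> []))"
  by (erule reach_test) simp

text \<open>A fold can extend a list only at its front and so delivers it backwards; this restores
  the order where it matters.\<close>

lemma reach_rev:
  assumes "reach A m F (\<lambda>i. enc_list enc (xs i))" "\<And>i. i \<in> A \<Longrightarrow> length (xs i) \<le> m i"
  shows "reach A m F (\<lambda>i. enc_list enc (rev (xs i)))"
proof -
  have "reach A m F (\<lambda>i. enc_list enc (rev (take (length (xs i)) (xs i))))"
  proof (rule reach_fold[where acc = "\<lambda>i k. enc_list enc (rev (take k (xs i)))", OF assms])
    fix F'
    let ?r = "reach {(i, k). i \<in> A \<and> k < length (xs i)} (\<lambda>j. m (fst j)) F'"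
    assume "?r (\<lambda>j. enc (xs (fst j) ! snd j))"
      and "?r (\<lambda>j. enc_list enc (rev (take (snd j) (xs (fst j)))))"
    then show "?r (\<lambda>j. enc_list enc (rev (take (Suc (snd j)) (xs (fst j)))))"
      by (rule reach_cong[OF reach_Node]) (auto simp: take_Suc_conv_app_nth)
  qed (auto intro: reach_Leaf)
  then show ?thesis by simp
qed

lemma reach_filter:
  assumes xs: "reach A m F (\<lambda>i. enc_list enc (xs i))"
    and len: "\<And>i. i \<in> A \<Longrightarrow> length (xs i) \<le> m i"
    and P: "\<And>F'. (\<And>g. reach A m F g \<Longrightarrow>
          reach {(i, k). i \<in> A \<and> k < length (xs i)} (\<lambda>j. m (fst j)) F' (\<lambda>j. g (fst j))) \<Longrightarrow>
        reach {(i, k). i \<in> A \<and> k < length (xs i)} (\<lambda>j. m (fst j)) F'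
          (\<lambda>j. enc (xs (fst j) ! snd j)) \<Longrightarrow>
        reach {(i, k). i \<in> A \<and> k < length (xs i)} (\<lambda>j. m (fst j)) F'
          (\<lambda>j. enc_bool (P (fst j) (xs (fst j) ! snd j)))"
  shows "reach A m F (\<lambda>i. enc_list enc (rev (filter (P i) (xs i))))"
proof -
  have "reach A m F (\<lambda>i. enc_list enc (rev (filter (P i) (take (length (xs i)) (xs i)))))"
  proof (rule reach_fold[where acc = "\<lambda>i k. enc_list enc (rev (filter (P i) (take k (xs i))))",
        OF xs len])
    fix F'
    let ?r = "reach {(i, k). i \<in> A \<and> k < length (xs i)} (\<lambda>j. m (fst j)) F'"
    assume env: "\<And>g. reach A m F g \<Longrightarrow> ?r (\<lambda>j. g (fst j))"
      and x: "?r (\<lambda>j. enc (xs (fst j) ! snd j))"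
      and acc: "?r (\<lambda>j. enc_list enc (rev (filter (P (fst j)) (take (snd j) (xs (fst j))))))"
    show "?r (\<lambda>j. enc_list enc (rev (filter (P (fst j)) (take (Suc (snd j)) (xs (fst j))))))"
      by (rule reach_cong[OF reach_if[OF P[OF env x] _
              reach_mono[OF reach_Node[OF x acc]] reach_mono[OF acc]]])
        (auto simp: take_Suc_conv_app_nth)
  qed (auto intro: reach_Leaf)
  then show ?thesis by simp
qed

lemma reach_Bex:
  assumes "reach A m F (\<lambda>i. enc_list enc (xs i))"
    and "\<And>i. i \<in> A \<Longrightarrow> length (xs i) \<le> m i"
    and "\<And>F'. (\<And>g. reach A m F g \<Longrightarrow>
          reach {(i, k). i \<in> A \<and> k < length (xs i)} (\<lambda>j. m (fst j)) F' (\<lambda>j. g (fst j))) \<Longrightarrow>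
        reach {(i, k). i \<in> A \<and> k < length (xs i)} (\<lambda>j. m (fst j)) F'
          (\<lambda>j. enc (xs (fst j) ! snd j)) \<Longrightarrow>
        reach {(i, k). i \<in> A \<and> k < length (xs i)} (\<lambda>j. m (fst j)) F'
          (\<lambda>j. enc_bool (P (fst j) (xs (fst j) ! snd j)))"
  shows "reach A m F (\<lambda>i. enc_bool (\<exists>x\<in>set (xs i). P i x))"
  by (rule reach_cong[OF reach_nonempty[OF reach_filter[of A m F enc xs P, OF assms]]])
    (auto simp: filter_empty_conv)

lemma head_enc_bits: "head (enc_bits bs) = enc_bool (bs \<noteq> [] \<and> hd bs)"
  by (cases bs) (auto simp: enc_bool_def)

text \<open>Without an equality test on trees, both strings are read in step. \<open>y\<close> may
  run out first, hence the nonemptiness guard in each round, or may be left over, hence the final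
  check. Only the length of \<open>x\<close> has to be bounded.\<close>

lemma reach_eq_bits:
  assumes x: "reach A m F (\<lambda>i. enc_bits (x i))" and y: "reach A m F (\<lambda>i. enc_bits (y i))"
    and len: "\<And>i. i \<in> A \<Longrightarrow> length (x i) \<le> m i"
  shows "reach A m F (\<lambda>i. enc_bool (x i = y i))"
proof -
  let ?acc = "\<lambda>i k. Node (enc_bool (take k (x i) = take k (y i))) (enc_bits (drop k (y i)))"
  have "reach A m F (\<lambda>i. ?acc i (length (x i)))"
  proof (rule reach_fold[where acc = ?acc, OF x len])
    show "reach A m F (\<lambda>i. ?acc i 0)"
      using reach_Node[OF reach_const[of A m F "enc_bool True"] y] by simp
    fix F'
    let ?r = "reach {(i, k). i \<in> A \<and> k < length (x i)} (\<lambda>j. m (fst j)) F'"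
    assume a: "?r (\<lambda>j. enc_bool (x (fst j) ! snd j))"
      and acc: "?r (\<lambda>j. ?acc (fst j) (snd j))"
    let ?d = "\<lambda>j. drop (snd j) (y (fst j))"
    have d: "?r (\<lambda>j. enc_bits (?d j))" by (rule reach_NodeD2[OF acc])
    have hd: "?r (\<lambda>j. enc_bool (?d j \<noteq> [] \<and> hd (?d j)))"
      using reach_head[OF d] by (simp add: head_enc_bits)
    have tl: "?r (\<lambda>j. enc_bits (drop (Suc (snd j)) (y (fst j))))"
      using reach_tail[OF d] by (simp add: tail_enc_list drop_Suc tl_drop)
    have "?r (\<lambda>j. enc_bool ((take (snd j) (x (fst j)) = take (snd j) (y (fst j)) \<and>
        ?d j \<noteq> []) \<and> (x (fst j) ! snd j \<longleftrightarrow> ?d j \<noteq> [] \<and> hd (?d j))))"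
      by (rule reach_conj[OF reach_conj[OF reach_NodeD1[OF acc] reach_nonempty[OF d]]
            reach_iff[OF a hd]])
    then have "?r (\<lambda>j. enc_bool (take (Suc (snd j)) (x (fst j)) = take (Suc (snd j)) (y (fst j))))"
    proof (rule reach_cong)
      fix j assume "j \<in> {(i, k). i \<in> A \<and> k < length (x i)}"
      then have k: "snd j < length (x (fst j))" by auto
      show "enc_bool ((take (snd j) (x (fst j)) = take (snd j) (y (fst j)) \<and> ?d j \<noteq> []) \<and>
          (x (fst j) ! snd j \<longleftrightarrow> ?d j \<noteq> [] \<and> hd (?d j))) =
          enc_bool (take (Suc (snd j)) (x (fst j)) = take (Suc (snd j)) (y (fst j)))"
      proof (cases "snd j < length (y (fst j))")
        case True
        then show ?thesis using k by (simp add: take_Suc_conv_app_nth hd_drop_conv_nth)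
      next
        case False
        then have "length (take (Suc (snd j)) (x (fst j))) \<noteq>
            length (take (Suc (snd j)) (y (fst j)))" using k by simp
        then have "take (Suc (snd j)) (x (fst j)) \<noteq> take (Suc (snd j)) (y (fst j))" by metis
        then show ?thesis using False by simp
      qed
    qed
    then show "?r (\<lambda>j. ?acc (fst j) (Suc (snd j)))" using tl by (rule reach_Node)
  qed
  note acc = reach_NodeD1[OF this] reach_NodeD2[OF this]
  have "reach A m F (\<lambda>i. enc_bool (take (length (x i)) (x i) = take (length (x i)) (y i) \<and>
      \<not> drop (length (x i)) (y i) \<noteq> []))"
    by (rule reach_conj[OF acc(1) reach_not[OF reach_nonempty[OF acc(2)]]])
  then show ?thesis
    by (rule reach_cong) (auto simp: enc_bool_def)
qed

section \<open>Comparison and successor in binary\<close>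

lemma bits_0: "bits 0 = []"
  by (simp add: bits.simps)

lemma bits_pos: "n > 0 \<Longrightarrow> bits n = odd n # bits (n div 2)"
  by (simp add: bits.simps[of n])

lemma head_enc_nat: "head (enc_nat n) = enc_bool (odd n)"
  by (cases "n = 0") (auto simp: bits_0 bits_pos enc_bool_def)

lemma tail_enc_nat: "tail (enc_nat n) = enc_nat (n div 2)"
  by (cases "n = 0") (auto simp: bits_0 bits_pos)

lemma bits_eq_Nil [simp]: "bits n = [] \<longleftrightarrow> n = 0"
  by (cases "n = 0") (auto simp: bits_0 bits_pos)

lemma less_power_length_bits: "n < 2 ^ length (bits n)"
proof (induction n rule: less_induct)
  case (less n)
  show ?case
  proof (cases "n = 0")
    case False
    then have "n div 2 < 2 ^ length (bits (n div 2))" using less by simp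
    then show ?thesis using False by (simp add: bits_pos)
  qed simp
qed

lemma length_bits_le: "length (bits n) \<le> n"
proof (induction n rule: less_induct)
  case (less n)
  show ?case
  proof (cases "n = 0")
    case False
    then have "length (bits (n div 2)) \<le> n div 2" using less by simp
    then show ?thesis using False by (simp add: bits_pos)
  qed (simp add: bits_0)
qed

lemma nth_bits: "k < length (bits n) \<Longrightarrow> bits n ! k = odd (n div 2 ^ k)"
proof (induction k arbitrary: n)
  case 0
  then have "n > 0" by (cases "n = 0") (auto simp: bits_0)
  then show ?case by (simp add: bits_pos)
next
  case (Suc k)
  then have n: "n > 0" by (cases "n = 0") (auto simp: bits_0)
  with Suc.prems have "k < length (bits (n div 2))" by (simp add: bits_pos)
  from Suc.IH[OF this] n show ?case by (simp add: bits_pos div_mult2_eq)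
qed

text \<open>Bits arrive with the least significant one first, so a new bit outweighs everything read
  before. If the new bits agree, the earlier verdict stands; otherwise they decide.\<close>

lemma mod_power_Suc_less_iff:
  fixes a b :: nat
  shows "a mod 2 ^ Suc k < b mod 2 ^ Suc k \<longleftrightarrow>
     (if odd (a div 2 ^ k) = odd (b div 2 ^ k) then a mod 2 ^ k < b mod 2 ^ k
      else odd (b div 2 ^ k))"
proof -
  have *: "n mod 2 ^ Suc k = 2 ^ k * (if odd (n div 2 ^ k) then 1 else 0) + n mod 2 ^ k"
    for n :: nat
    using mod_mult2_eq[of n "2 ^ k" 2] by (simp add: mult.commute odd_iff_mod_2_eq_one)
  have "a mod 2 ^ k < 2 ^ k + b mod 2 ^ k" "b mod 2 ^ k < 2 ^ k + a mod 2 ^ k"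
    by (simp_all add: trans_less_add1)
  then show ?thesis
    unfolding * by (cases "odd (a div 2 ^ k)"; cases "odd (b div 2 ^ k)") simp_all
qed

text \<open>The scan ends with the bits of \<open>a\<close>; if any bits of \<open>b\<close> are
  left then, \<open>b\<close> is larger. Only \<open>a\<close> needs a bound, which is essential
  where \<open>b\<close> is \<open>2 * r\<close>, a number that the time bound does not
  control.\<close>

lemma reach_less:
  assumes a: "reach A m F (\<lambda>i. enc_nat (a i))" and b: "reach A m F (\<lambda>i. enc_nat (b i))"
    and len: "\<And>i. i \<in> A \<Longrightarrow> length (bits (a i)) \<le> m i"
  shows "reach A m F (\<lambda>i. enc_bool (a i < b i))"
proof -
  let ?acc = "\<lambda>i k. Node (enc_bool (a i mod 2 ^ k < b i mod 2 ^ k)) (enc_nat (b i div 2 ^ k))"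
  have "reach A m F (\<lambda>i. ?acc i (length (bits (a i))))"
  proof (rule reach_fold[where acc = ?acc, OF a len])
    show "reach A m F (\<lambda>i. ?acc i 0)"
      using reach_Node[OF reach_const[of A m F "enc_bool False"] b] by (simp add: enc_bool_def)
    fix F'
    let ?r = "reach {(i, k). i \<in> A \<and> k < length (bits (a i))} (\<lambda>j. m (fst j)) F'"
    assume x: "?r (\<lambda>j. enc_bool (bits (a (fst j)) ! snd j))"
      and acc: "?r (\<lambda>j. ?acc (fst j) (snd j))"
    have d: "?r (\<lambda>j. enc_nat (b (fst j) div 2 ^ snd j))" by (rule reach_NodeD2[OF acc])
    have hd: "?r (\<lambda>j. enc_bool (odd (b (fst j) div 2 ^ snd j)))"
      using reach_head[OF d] by (simp only: head_enc_nat)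
    have tl: "?r (\<lambda>j. enc_nat (b (fst j) div 2 ^ Suc (snd j)))"
      using reach_tail[OF d] by (simp only: tail_enc_nat power_Suc2 div_mult2_eq)
    have hd': "?r (\<lambda>j. enc_bool (odd (a (fst j) div 2 ^ snd j)))"
      by (rule reach_cong[OF x]) (auto simp: nth_bits)
    have "?r (\<lambda>j. if odd (a (fst j) div 2 ^ snd j) = odd (b (fst j) div 2 ^ snd j)
        then enc_bool (a (fst j) mod 2 ^ snd j < b (fst j) mod 2 ^ snd j)
        else enc_bool (odd (b (fst j) div 2 ^ snd j)))"
      by (rule reach_if[OF reach_iff[OF hd' hd] _ reach_mono[OF reach_NodeD1[OF acc]]
            reach_mono[OF hd]]) auto
    then have "?r (\<lambda>j. enc_bool
        (a (fst j) mod 2 ^ Suc (snd j) < b (fst j) mod 2 ^ Suc (snd j)))"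
      by (rule reach_cong) (simp add: mod_power_Suc_less_iff del: power_Suc)
    then show "?r (\<lambda>j. ?acc (fst j) (Suc (snd j)))" using tl by (rule reach_Node)
  qed
  note acc = reach_NodeD1[OF this] reach_NodeD2[OF this]
  have "reach A m F (\<lambda>i. enc_bool
      (a i mod 2 ^ length (bits (a i)) < b i mod 2 ^ length (bits (a i)) \<or>
       bits (b i div 2 ^ length (bits (a i))) \<noteq> []))"
    by (rule reach_disj[OF acc(1) reach_nonempty[OF acc(2)]])
  then show ?thesis
  proof (rule reach_cong)
    fix i
    let ?p = "2 ^ length (bits (a i)) :: nat"
    have a: "a i < ?p" by (rule less_power_length_bits)
    have "(a i mod ?p < b i mod ?p \<or> b i div ?p \<noteq> 0) \<longleftrightarrow> a i < b i"
    proof (cases "b i < ?p")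
      case False
      then have "b i div ?p \<noteq> 0" by (simp add: div_eq_0_iff)
      then show ?thesis using False a by simp
    qed (use a in simp)
    then show "enc_bool (a i mod ?p < b i mod ?p \<or> bits (b i div ?p) \<noteq> []) =
        enc_bool (a i < b i)"
      by simp
  qed
qed

fun add_carry :: "bool \<Rightarrow> bool list \<Rightarrow> bool list" where
  "add_carry c [] = (if c then [True] else [])"
| "add_carry c (b # bs) = (b \<noteq> c) # add_carry (b \<and> c) bs"

lemma add_carry_False: "add_carry False bs = bs"
  by (induction bs) auto

lemma bits_Suc: "bits (Suc n) = add_carry True (bits n)"
proof (induction n rule: less_induct)
  case (less n)
  show ?case
  proof (cases "odd n")
    case True
    then have "n > 0" by (cases n) auto
    moreover have "Suc n div 2 = Suc (n div 2)" using True by presburger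
    ultimately show ?thesis using True less[of "n div 2"] by (simp add: bits_pos)
  next
    case False
    then have "Suc n div 2 = n div 2" by presburger
    then show ?thesis
      using False by (cases "n = 0") (simp_all add: bits_pos bits_0 add_carry_False)
  qed
qed

lemma length_add_carry:
  "length (add_carry c bs) = length bs + (if c \<and> (\<forall>b\<in>set bs. b) then 1 else 0)"
  by (induction bs arbitrary: c) auto

text \<open>The carry reaches position \<open>k\<close> exactly if it enters at the bottom and all
  lower bits are ones. A fold can maintain this condition as a single flag.\<close>

lemma nth_add_carry:
  "k < length bs \<Longrightarrow> add_carry c bs ! k = (bs ! k \<noteq> (c \<and> (\<forall>b\<in>set (take k bs). b)))"
proof (induction bs arbitrary: c k)
  case (Cons b bs)
  then show ?case by (cases k) auto
qed simp

lemma drop_add_carry: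
  "drop (length bs) (add_carry c bs) = (if c \<and> (\<forall>b\<in>set bs. b) then [True] else [])"
  by (induction bs arbitrary: c) auto

text \<open>One pass keeps the carry flag and the reversed output; a carry that survives the pass
  contributes a final \<open>True\<close>. The unary bound on \<open>Suc a\<close> is crude, but all
  counters here are bounded by list lengths or by the degree.\<close>

lemma reach_Suc:
  assumes a: "reach A m F (\<lambda>i. enc_nat (a i))"
    and len: "\<And>i. i \<in> A \<Longrightarrow> Suc (a i) \<le> m i"
  shows "reach A m F (\<lambda>i. enc_nat (Suc (a i)))"
proof -
  let ?c = "\<lambda>i k. \<forall>b\<in>set (take k (bits (a i))). b"
  let ?s = "\<lambda>i. add_carry True (bits (a i))"
  let ?acc = "\<lambda>i k. Node (enc_bool (?c i k)) (enc_bits (rev (take k (?s i))))"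
  have len': "length (bits (a i)) \<le> m i" if "i \<in> A" for i
    using len[OF that] length_bits_le[of "a i"] by simp
  have "reach A m F (\<lambda>i. ?acc i (length (bits (a i))))"
  proof (rule reach_fold[where acc = ?acc, OF a len'])
    show "reach A m F (\<lambda>i. ?acc i 0)"
      using reach_const[of A m F "Node (enc_bool True) Leaf"] by simp
    fix F'
    let ?r = "reach {(i, k). i \<in> A \<and> k < length (bits (a i))} (\<lambda>j. m (fst j)) F'"
    assume x: "?r (\<lambda>j. enc_bool (bits (a (fst j)) ! snd j))"
      and acc: "?r (\<lambda>j. ?acc (fst j) (snd j))"
    have c: "?r (\<lambda>j. enc_bool (?c (fst j) (snd j)))" by (rule reach_NodeD1[OF acc])
    have "?r (\<lambda>j. enc_bool (?c (fst j) (snd j) \<and> bits (a (fst j)) ! snd j))"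
      by (rule reach_conj[OF c x])
    then have c': "?r (\<lambda>j. enc_bool (?c (fst j) (Suc (snd j))))"
      by (rule reach_cong) (clarsimp simp: take_Suc_conv_app_nth conj_commute)
    have "?r (\<lambda>j. enc_bool (\<not> (bits (a (fst j)) ! snd j \<longleftrightarrow> ?c (fst j) (snd j))))"
      by (rule reach_not[OF reach_iff[OF x c]])
    then have "?r (\<lambda>j. enc_bits (rev (take (Suc (snd j)) (?s (fst j)))))"
      by (rule reach_cong[OF reach_Node[OF _ reach_NodeD2[OF acc]]])
        (auto simp: take_Suc_conv_app_nth length_add_carry nth_add_carry)
    then show "?r (\<lambda>j. ?acc (fst j) (Suc (snd j)))" by (rule reach_Node[OF c'])
  qed
  note acc = reach_NodeD1[OF this] reach_NodeD2[OF this]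
  let ?t = "\<lambda>i. take (length (bits (a i))) (?s i)"
  have "reach A m F (\<lambda>i. if \<forall>b\<in>set (bits (a i)). b
      then enc_bits (True # rev (?t i)) else enc_bits (rev (?t i)))"
    unfolding enc_list.simps
    by (rule reach_if[OF acc(1)[unfolded take_all[OF order_refl]] _ reach_Node[OF reach_const reach_mono[OF acc(2)]]
          reach_mono[OF acc(2)]]) auto
  then have s: "reach A m F (\<lambda>i. enc_bits (rev (?s i)))"
  proof (rule reach_cong)
    fix i
    have "rev (?s i) = (if \<forall>b\<in>set (bits (a i)). b then True # rev (?t i) else rev (?t i))"
      by (rule trans[OF arg_cong[OF append_take_drop_id[of "length (bits (a i))" "?s i", symmetric], of rev]])
        (simp add: drop_add_carry)
    then show "(if \<forall>b\<in>set (bits (a i)). b then enc_bits (True # rev (?t i))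
        else enc_bits (rev (?t i))) = enc_bits (rev (?s i))"
      by presburger
  qed
  have "length (?s i) \<le> m i" if "i \<in> A" for i
    using len[OF that] length_bits_le[of "Suc (a i)"] by (simp add: bits_Suc)
  then have "reach A m F (\<lambda>i. enc_bits (rev (rev (?s i))))"
    by (intro reach_rev[OF s]) simp
  then show ?thesis by (simp only: rev_rev_ident bits_Suc)
qed

lemma reach_length:
  assumes xs: "reach A m F (\<lambda>i. enc_list enc (xs i))"
    and len: "\<And>i. i \<in> A \<Longrightarrow> length (xs i) \<le> m i"
  shows "reach A m F (\<lambda>i. enc_nat (length (xs i)))"
proof (rule reach_fold[where acc = "\<lambda>i k. enc_nat k", OF xs len])
  show "reach A m F (\<lambda>i. enc_nat 0)" by (rule reach_const)
  fix F'
  let ?r = "reach {(i, k). i \<in> A \<and> k < length (xs i)} (\<lambda>j. m (fst j)) F'"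
  assume "?r (\<lambda>j. enc_nat (snd j))"
  then show "?r (\<lambda>j. enc_nat (Suc (snd j)))"
    by (rule reach_Suc) (auto dest: len)
qed

subsection \<open>Greedy assignment on levels\<close>

text \<open>A level is a list of left nodes with the right nodes assigned to them. On each level every
  right node is assigned at most \<open>2 * r\<close> times; a left node for which this leaves fewer than \<open>l\<close>
  edges is passed on to the next level.\<close>

type_synonym ('a, 'b) level = "('a \<times> 'b list) list"

text \<open>Counts entries and ignores the multiplicity of \<open>p\<close> within an entry:
  condition (5) limits distinct left nodes, so parallel edges are charged once.\<close>

definition load :: "('a, 'b) level \<Rightarrow> 'b \<Rightarrow> nat" where
  "load lv p = length (filter (\<lambda>e. p \<in> set (snd e)) lv)"

text \<open>The reversal is an artefact of filtering with an accumulator.\<close>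

definition available :: "nat \<Rightarrow> ('a, 'b) level \<Rightarrow> 'b list \<Rightarrow> 'b list" where
  "available r lv ps = rev (filter (\<lambda>p. load lv p < 2 * r) ps)"

text \<open>A new level carries no load, so all of \<open>ps\<close> is available there and nothing
  is filtered. That \<open>ps\<close> is long enough is left to the hypotheses of
  \<open>legal_place\<close>.\<close>

fun place :: "nat \<Rightarrow> nat \<Rightarrow> 'a \<Rightarrow> 'b list \<Rightarrow> ('a, 'b) level list \<Rightarrow> ('a, 'b) level list" where
  "place r l x ps [] = [[(x, ps)]]"
| "place r l x ps (lv # lvs) =
     (if l \<le> length (available r lv ps) then ((x, available r lv ps) # lv) # lvs
      else lv # place r l x ps lvs)"

abbreviation nodes :: "('a, 'b) level list \<Rightarrow> 'a list" where
  "nodes lvs \<equiv> map fst (concat lvs)"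

text \<open>A repeated element keeps its first entry; a second one would break the distinctness of
  nodes on which lookup and counting rest.\<close>

definition insert_node ::
    "nat \<Rightarrow> nat \<Rightarrow> ('a \<Rightarrow> 'b list) \<Rightarrow> ('a, 'b) level list \<Rightarrow> 'a \<Rightarrow> ('a, 'b) level list" where
  "insert_node r l nbs lvs x =
     (if x \<in> set (nodes lvs) then lvs else place r l x (nbs x) lvs)"

definition levels_of ::
    "nat \<Rightarrow> nat \<Rightarrow> ('a \<Rightarrow> 'b list) \<Rightarrow> 'a list \<Rightarrow> ('a, 'b) level list" where
  "levels_of r l nbs S = foldl (insert_node r l nbs) [] S"

text \<open>The default \<open>[]\<close> for nodes without an entry yields the empty multiset of
  condition (2).\<close>

definition assigned :: "('a, 'b) level list \<Rightarrow> 'a \<Rightarrow> 'b list" where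
  "assigned lvs x = (case map_of (concat lvs) x of None \<Rightarrow> [] | Some ps \<Rightarrow> ps)"

text \<open>A level only fills up, so a left node that has been passed on would still be passed on by
  the present level.\<close>

fun legal :: "nat \<Rightarrow> nat \<Rightarrow> ('a \<Rightarrow> 'b list) \<Rightarrow> ('a, 'b) level list \<Rightarrow> bool" where
  "legal r l nbs [] = True"
| "legal r l nbs (lv # lvs) =
     (lv \<noteq> [] \<and>
      (\<forall>(x, ps)\<in>set lv. mset ps \<subseteq># mset (nbs x) \<and> l \<le> length ps) \<and>
      (\<forall>p. load lv p \<le> 2 * r) \<and>
      (\<forall>x\<in>set (nodes lvs). length (available r lv (nbs x)) < l) \<and>
      legal r l nbs lvs)"

lemma load_Cons: "load (e # lv) p = load lv p + (if p \<in> set (snd e) then 1 else 0)"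
  by (simp add: load_def)

lemma set_available: "set (available r lv ps) = {p \<in> set ps. load lv p < 2 * r}"
  by (auto simp: available_def)

lemma mset_available: "mset (available r lv ps) = filter_mset (\<lambda>p. load lv p < 2 * r) (mset ps)"
  by (simp add: available_def mset_filter)

lemma length_available_Cons: "length (available r (e # lv) ps) \<le> length (available r lv ps)"
  by (induction ps) (auto simp: available_def load_Cons)

lemma length_available_le: "length (available r lv ps) \<le> length ps"
  by (simp add: available_def)

section \<open>Invariants of the level structure\<close>

lemma ex_mset_place:
  "\<exists>qs. mset (concat (place r l x ps lvs)) = add_mset (x, qs) (mset (concat lvs))"
  by (induction lvs) auto

lemma set_subset_place: "set (concat lvs) \<subseteq> set (concat (place r l x ps lvs))"
  by (induction lvs) auto

lemma mset_nodes_place: "mset (nodes (place r l x ps lvs)) = add_mset x (mset (nodes lvs))"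
  using ex_mset_place[of r l x ps lvs] by (metis fst_conv image_mset_add_mset mset_map)

lemma set_nodes_place: "set (nodes (place r l x ps lvs)) = insert x (set (nodes lvs))"
  using mset_nodes_place[of r l x ps lvs] by (metis set_mset_add_mset_insert set_mset_mset)

lemma distinct_nodes_place:
  "distinct (nodes lvs) \<Longrightarrow> x \<notin> set (nodes lvs) \<Longrightarrow> distinct (nodes (place r l x ps lvs))"
  using mset_nodes_place[of r l x ps lvs] by (metis distinct.simps(2) mset.simps(2) mset_eq_imp_distinct_iff)

text \<open>If the first level accepts, the load grows only at nodes below the cap, and availability
  only shrinks, so earlier refusals remain valid. If it refuses, the refusal itself is the condition
  for the newly passed-on node. A fresh level is legal because one entry has load at most 1 and
  \<open>x\<close> has at least \<open>l\<close> edges.\<close>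

lemma legal_place:
  assumes "legal r l nbs lvs" "1 \<le> r" "l \<le> length (nbs x)"
  shows "legal r l nbs (place r l x (nbs x) lvs)"
  using assms(1)
proof (induction lvs)
  case Nil
  then show ?case using assms by (auto simp: load_def)
next
  case (Cons lv lvs)
  then have lv: "\<forall>(x, ps)\<in>set lv. mset ps \<subseteq># mset (nbs x) \<and> l \<le> length ps"
    and ld: "load lv p \<le> 2 * r"
    and few: "y \<in> set (nodes lvs) \<Longrightarrow> length (available r lv (nbs y)) < l"
    and lvs: "lv \<noteq> []" "legal r l nbs lvs" for p y
    unfolding legal.simps by blast+
  show ?case
  proof (cases "l \<le> length (available r lv (nbs x))")
    case True
    let ?e = "(x, available r lv (nbs x))"
    have "load (?e # lv) p \<le> 2 * r" for p
      using ld[of p] by (simp add: load_Cons set_available)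
    moreover have "length (available r (?e # lv) (nbs y)) < l" if "y \<in> set (nodes lvs)" for y
      using le_less_trans[OF length_available_Cons few[OF that]] .
    moreover have "mset (available r lv (nbs x)) \<subseteq># mset (nbs x)"
      by (simp add: mset_available)
    ultimately show ?thesis
      unfolding place.simps if_P[OF True] legal.simps using lv lvs True by simp
  next
    case False
    then have "length (available r lv (nbs y)) < l"
      if "y \<in> set (nodes (place r l x (nbs x) lvs))" for y
      using that few unfolding set_nodes_place by auto
    then show ?thesis
      unfolding place.simps if_not_P[OF False] legal.simps using lv ld lvs Cons.IH by blast
  qed
qed

lemma levels_of_snoc: "levels_of r l nbs (S @ [x]) = insert_node r l nbs (levels_of r l nbs S) x"
  by (simp add: levels_of_def)

lemma levels_of_invariants:
  assumes "1 \<le> r" "\<And>x. x \<in> set S \<Longrightarrow> l \<le> length (nbs x)"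
  shows "legal r l nbs (levels_of r l nbs S)" "distinct (nodes (levels_of r l nbs S))"
    "set (nodes (levels_of r l nbs S)) = set S"
proof -
  have "legal r l nbs (levels_of r l nbs S) \<and> distinct (nodes (levels_of r l nbs S)) \<and>
    set (nodes (levels_of r l nbs S)) = set S"
    using assms(2)
  proof (induction S rule: rev_induct)
    case Nil
    then show ?case by (simp add: levels_of_def)
  next
    case (snoc x S)
    then have IH: "legal r l nbs (levels_of r l nbs S)" "distinct (nodes (levels_of r l nbs S))"
      "set (nodes (levels_of r l nbs S)) = set S" and x: "l \<le> length (nbs x)"
      by (simp_all del: set_map set_concat)
    show ?case
      unfolding levels_of_snoc insert_node_def
      using IH legal_place[OF IH(1) assms(1) x] distinct_nodes_place[OF IH(2)]
      by (simp add: set_nodes_place insert_absorb del: set_map set_concat)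
  qed
  then show "legal r l nbs (levels_of r l nbs S)" "distinct (nodes (levels_of r l nbs S))"
    "set (nodes (levels_of r l nbs S)) = set S" by blast+
qed

lemma set_subset_insert_node: "set (concat lvs) \<subseteq> set (concat (insert_node r l nbs lvs x))"
proof (cases "x \<in> set (nodes lvs)")
  case True
  show ?thesis unfolding insert_node_def if_P[OF True] by (rule order_refl)
next
  case False
  show ?thesis unfolding insert_node_def if_not_P[OF False] by (rule set_subset_place)
qed

text \<open>Entries are never revised or removed. As each node has only one entry, its assignment
  survives every extension of the list, which is condition (3).\<close>

lemma levels_of_append_mono:
  "set (concat (levels_of r l nbs S)) \<subseteq> set (concat (levels_of r l nbs (S @ T)))"
proof (induction T rule: rev_induct)
  case (snoc x T)
  also have "set (concat (levels_of r l nbs (S @ T))) \<subseteq>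
      set (concat (levels_of r l nbs (S @ T @ [x])))"
    unfolding append_assoc[symmetric] levels_of_snoc by (rule set_subset_insert_node)
  finally show ?case .
qed simp

lemma assigned_eq:
  "distinct (nodes lvs) \<Longrightarrow> (x, ps) \<in> set (concat lvs) \<Longrightarrow> assigned lvs x = ps"
  unfolding assigned_def by (simp add: map_of_is_SomeI del: set_concat)

lemma assigned_eq_Nil: "x \<notin> set (nodes lvs) \<Longrightarrow> assigned lvs x = []"
  unfolding assigned_def by (simp add: map_of_eq_None_iff[THEN iffD2] del: set_concat)

lemma legal_entry:
  assumes "legal r l nbs lvs" "(x, ps) \<in> set (concat lvs)"
  shows "mset ps \<subseteq># mset (nbs x)" "l \<le> length ps"
  using assms by (induction lvs) auto

lemma legal_length: "legal r l nbs lvs \<Longrightarrow> length lvs \<le> length (concat lvs)"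
  by (induction lvs) (auto simp: Suc_le_eq trans_less_add2 neq_Nil_conv)

lemma levels_of_size:
  assumes "1 \<le> r" "\<And>x. x \<in> set S \<Longrightarrow> l \<le> length (nbs x)"
  shows "length (concat (levels_of r l nbs S)) \<le> length S"
    and "length (levels_of r l nbs S) \<le> length S"
    and "e \<in> set (concat (levels_of r l nbs S)) \<Longrightarrow> length (snd e) \<le> length (nbs (fst e))"
proof -
  note inv = levels_of_invariants[of r S l nbs, OF assms]
  have "length (concat (levels_of r l nbs S)) = card (set S)"
    using distinct_card[OF inv(2)] inv(3) by simp
  then show c: "length (concat (levels_of r l nbs S)) \<le> length S"
    using card_length[of S] by simp
  show "length (levels_of r l nbs S) \<le> length S"
    using legal_length[OF inv(1)] c by (rule le_trans)
  assume "e \<in> set (concat (levels_of r l nbs S))"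
  then have "mset (snd e) \<subseteq># mset (nbs (fst e))"
    using legal_entry(1)[OF inv(1)] by (metis prod.collapse)
  from size_mset_mono[OF this] show "length (snd e) \<le> length (nbs (fst e))" by simp
qed

lemma legal_load:
  assumes "legal r l nbs lvs"
  shows "load (concat lvs) p \<le> length lvs * (2 * r)"
  using assms
proof (induction lvs)
  case (Cons lv lvs)
  have "load (concat (lv # lvs)) p = load lv p + load (concat lvs) p" by (simp add: load_def)
  also have "\<dots> \<le> 2 * r + length lvs * (2 * r)" using Cons by (intro add_mono) auto
  finally show ?case by simp
qed (simp add: load_def)

lemma card_assigned_le:
  assumes "distinct (nodes lvs)" "set (nodes lvs) = A"
  shows "card {x \<in> A. p \<in> set (assigned lvs x)} \<le> load (concat lvs) p"
proof -
  let ?es = "filter (\<lambda>e. p \<in> set (snd e)) (concat lvs)"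
  have "{x \<in> A. p \<in> set (assigned lvs x)} \<subseteq> set (map fst ?es)"
  proof
    fix x assume "x \<in> {x \<in> A. p \<in> set (assigned lvs x)}"
    then have x: "x \<in> set (nodes lvs)" and p: "p \<in> set (assigned lvs x)" using assms by auto
    from x obtain ps where ps: "(x, ps) \<in> set (concat lvs)"
      unfolding list.set_map by (metis imageE prod.collapse)
    then have "p \<in> set ps" using assigned_eq[OF assms(1) ps] p by simp
    with ps have "(x, ps) \<in> set ?es" by simp
    then show "x \<in> set (map fst ?es)" by force
  qed
  then have "card {x \<in> A. p \<in> set (assigned lvs x)} \<le> card (set (map fst ?es))"
    by (intro card_mono) auto
  also have "\<dots> \<le> length (map fst ?es)" by (rule card_length)
  finally show ?thesis by (simp add: load_def)
qed

section \<open>Counting edges to full nodes\<close>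

lemma size_filter_mset_eq_sum:
  assumes "finite B"
  shows "size {#e \<in># M. f e \<in> B#} = (\<Sum>b\<in>B. size {#e \<in># M. f e = b#})"
proof (induction M)
  case (add e M)
  have "(\<Sum>b\<in>B. size {#x \<in># add_mset e M. f x = b#}) =
      (\<Sum>b\<in>B. size {#x \<in># M. f x = b#} + (if f e = b then 1 else 0))"
    by (rule sum.cong) auto
  then show ?case using add assms by (simp add: sum.distrib)
qed simp

lemma card_set_mset_le: "card (set_mset M) \<le> size M"
  using size_mset_mono[OF mset_set_set_mset_msubset[of M]] by simp

text \<open>Entries that use \<open>p\<close> belong to different left nodes, so each contributes
  its own edge \<open>(x, p)\<close>. Parallel edges can only enlarge the right-hand side.\<close>

lemma edges_between_load:
  assumes "distinct (map fst lv)" "fst ` set lv \<subseteq> A"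
    and "\<And>x ps. (x, ps) \<in> set lv \<Longrightarrow> mset ps \<subseteq># neighbors G x"
  shows "load lv p \<le> size (edges_between G A p)"
proof -
  let ?es = "filter (\<lambda>e. p \<in> set (snd e)) lv"
  have "distinct (map fst ?es)" using assms(1) by (simp add: distinct_map_filter)
  then have "load lv p = card (fst ` set ?es)"
    unfolding load_def by (metis distinct_card length_map list.set_map)
  also have "\<dots> = card ((\<lambda>x. (x, p)) ` fst ` set ?es)"
    by (rule card_image[symmetric]) (simp add: inj_on_def)
  also have "\<dots> \<le> card (set_mset (edges_between G A p))"
  proof (intro card_mono subsetI)
    fix e assume "e \<in> (\<lambda>x. (x, p)) ` fst ` set ?es"
    then obtain x ps where e: "e = (x, p)" "(x, ps) \<in> set lv" "p \<in> set ps" by auto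
    then have "p \<in># neighbors G x" using mset_subset_eqD[OF assms(3), of x ps p] by simp
    then have "(x, p) \<in># edges G" by (auto simp: neighbors_def)
    moreover have "x \<in> A" using e(2) assms(2) by force
    ultimately show "e \<in> set_mset (edges_between G A p)"
      using e by (simp add: edges_between_def)
  qed simp
  also have "\<dots> \<le> size (edges_between G A p)" by (rule card_set_mset_le)
  finally show ?thesis .
qed

text \<open>A right node that is full on a level has at least \<open>2 * r\<close> edges to the nodes \<open>A\<close> that have
  arrived there, so at least half of these edges count for the excess of \<open>A\<close>. A node that
  is passed on has more than \<open>4 * \<epsilon> * D\<close> edges to full nodes.\<close>

lemma passed_on_less_half:
  assumes G: "bipartite G" "left_degree G D" "bounded_right_degree G D r K \<epsilon>"
    and r: "1 \<le> r" and eps: "0 < \<epsilon>"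
    and nbs: "\<And>x. x \<in> left G \<Longrightarrow> mset (nbs x) = neighbors G x"
    and A: "A \<subseteq> left G" "card A \<le> K" "F \<subseteq> A" "F \<noteq> {}"
    and lv: "distinct (map fst lv)" "fst ` set lv \<subseteq> A"
      "\<And>x ps. (x, ps) \<in> set lv \<Longrightarrow> mset ps \<subseteq># mset (nbs x)"
    and F: "\<And>x. x \<in> F \<Longrightarrow> length (available r lv (nbs x)) < nat \<lceil>(1 - 4 * \<epsilon>) * real D\<rceil>"
  shows "2 * card F < card A"
proof -
  have "finite A" using A G by (auto simp: bipartite_def intro: finite_subset)
  then have finF: "finite F" using A by (auto intro: finite_subset)
  define U where "U = {p \<in> nbr_set G A. 2 * r \<le> load lv p}"
  have finU: "finite U" using G by (auto simp: U_def nbr_set_def bipartite_def)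
  let ?full = "\<lambda>x. size {#e \<in># edges G. fst e = x \<and> 2 * r \<le> load lv (snd e)#}"
  have full: "4 * \<epsilon> * real D < real (?full x)" if x: "x \<in> F" for x
  proof -
    have xL: "x \<in> left G" using x A by auto
    let ?E = "{#e \<in># edges G. fst e = x#}"
    have "length (available r lv (nbs x)) = size (mset (available r lv (nbs x)))"
      by simp
    also have "\<dots> = size {#p \<in># neighbors G x. load lv p < 2 * r#}"
      by (simp only: mset_available nbs[OF xL])
    also have "\<dots> = size {#e \<in># ?E. load lv (snd e) < 2 * r#}"
      by (simp add: neighbors_def filter_mset_image_mset)
    finally have av: "length (available r lv (nbs x)) = size {#e \<in># ?E. load lv (snd e) < 2 * r#}" .
    have "D = size ?E" using G xL by (simp add: left_degree_def)
    also have "\<dots> = size {#e \<in># ?E. load lv (snd e) < 2 * r#} +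
        size {#e \<in># ?E. \<not> load lv (snd e) < 2 * r#}"
      by (metis multiset_partition size_union)
    also have "{#e \<in># ?E. \<not> load lv (snd e) < 2 * r#} =
        {#e \<in># edges G. fst e = x \<and> 2 * r \<le> load lv (snd e)#}"
      by (simp add: filter_filter_mset not_less conj_commute)
    finally have "real D = real (length (available r lv (nbs x))) + real (?full x)"
      using av by simp
    \<comment> \<open>A natural number below the ceiling of a real number is below that number
      itself, so no rounding is lost and the inequality stays strict.\<close>
    moreover have "real (length (available r lv (nbs x))) < (1 - 4 * \<epsilon>) * real D"
      using F[OF x] by linarith
    ultimately show ?thesis by (simp add: algebra_simps)
  qed
  have "4 * \<epsilon> * real D * real (card F) = (\<Sum>x\<in>F. 4 * \<epsilon> * real D)" by simp
  also have "\<dots> < (\<Sum>x\<in>F. real (?full x))"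
    by (rule sum_strict_mono[OF finF A(4) full])
  also have "\<dots> = real (\<Sum>x\<in>F. ?full x)" by simp
  \<comment> \<open>Double counting: the edges to full nodes are collected here by their left
    endpoint and below by their right endpoint.\<close>
  also have "(\<Sum>x\<in>F. ?full x) = size {#e \<in># edges G. fst e \<in> F \<and> 2 * r \<le> load lv (snd e)#}"
    using size_filter_mset_eq_sum[OF finF, of fst "{#e \<in># edges G. 2 * r \<le> load lv (snd e)#}"]
    by (simp add: filter_filter_mset conj_commute)
  \<comment> \<open>\<open>F\<close> is enlarged to \<open>A\<close> because the load comes from
    entries of \<open>lv\<close>, whose nodes lie in \<open>A\<close> but need not lie in
    \<open>F\<close>; only edges from \<open>A\<close> can be compared with it.\<close>
  also have "\<dots> \<le> size {#e \<in># edges G. fst e \<in> A \<and> snd e \<in> U#}"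
  proof (rule size_mset_mono, rule subset_mset.order_trans)
    show "{#e \<in># edges G. fst e \<in> F \<and> 2 * r \<le> load lv (snd e)#} \<subseteq>#
        {#e \<in># edges G. fst e \<in> A \<and> 2 * r \<le> load lv (snd e)#}"
      using A(3) by (intro filter_mset_mono_strong) auto
    have "fst e \<in> A \<and> 2 * r \<le> load lv (snd e) \<longleftrightarrow> fst e \<in> A \<and> snd e \<in> U"
      if "e \<in># edges G" for e
      using that G(1) by (cases e) (auto simp: U_def nbr_set_def bipartite_def)
    then show "{#e \<in># edges G. fst e \<in> A \<and> 2 * r \<le> load lv (snd e)#} \<subseteq>#
        {#e \<in># edges G. fst e \<in> A \<and> snd e \<in> U#}"
      by (metis (mono_tags, lifting) filter_mset_cong subset_mset.order_refl)
  qed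
  also have "size {#e \<in># edges G. fst e \<in> A \<and> snd e \<in> U#} =
      (\<Sum>p\<in>U. size (edges_between G A p))"
    using size_filter_mset_eq_sum[OF finU, of snd "{#e \<in># edges G. fst e \<in> A#}"]
    by (simp add: edges_between_def filter_filter_mset conj_commute)
  also have "\<dots> \<le> (\<Sum>p\<in>U. 2 * excess_at G A p r)"
  proof (rule sum_mono)
    fix p assume "p \<in> U"
    then have "2 * r \<le> load lv p" by (simp add: U_def)
    also have "load lv p \<le> size (edges_between G A p)"
    proof (rule edges_between_load[OF lv(1,2)])
      fix x ps assume "(x, ps) \<in> set lv"
      moreover from this have "x \<in> left G" using lv(2) A(1) by force
      ultimately show "mset ps \<subseteq># neighbors G x" using lv(3) nbs by metis
    qed
    finally show "size (edges_between G A p) \<le> 2 * excess_at G A p r"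
      by (simp add: excess_at_def)
  qed
  also have "\<dots> \<le> (\<Sum>p\<in>nbr_set G A. 2 * excess_at G A p r)"
    using G by (intro sum_mono2) (auto simp: U_def nbr_set_def bipartite_def)
  also have "\<dots> = 2 * excess G A r" by (simp add: excess_def sum_distrib_left)
  finally have "4 * \<epsilon> * real D * real (card F) < 2 * real (excess G A r)" by simp
  also have "\<dots> \<le> 2 * (\<epsilon> * real D * real (card A))"
    using G(3) A by (simp add: bounded_right_degree_def)
  finally have less: "(2 * \<epsilon> * real D) * (2 * real (card F)) < (2 * \<epsilon> * real D) * real (card A)"
    by (simp add: algebra_simps)
  \<comment> \<open>Cancelling a common factor from a strict inequality needs only a nonnegative
    factor, so \<open>D = 0\<close> is no special case.\<close>
  have "2 * real (card F) < real (card A)"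
    by (rule mult_left_less_imp_less[OF less]) (use eps in simp)
  then show ?thesis by linarith
qed

text \<open>From \<open>2 * a < b\<close> follows \<open>2 * (a + 1) \<le> b + 1\<close>: the number
  of nodes plus one at least doubles with every level put in front, which is why the induction
  carries the summand 1.\<close>

lemma power_length_levels_le:
  assumes G: "bipartite G" "left_degree G D" "bounded_right_degree G D r K \<epsilon>"
    and r: "1 \<le> r" and eps: "0 < \<epsilon>"
    and nbs: "\<And>x. x \<in> left G \<Longrightarrow> mset (nbs x) = neighbors G x"
    and "legal r (nat \<lceil>(1 - 4 * \<epsilon>) * real D\<rceil>) nbs lvs"
    and "distinct (nodes lvs)" "set (nodes lvs) \<subseteq> left G" "length (nodes lvs) \<le> K"
  shows "2 ^ length lvs \<le> length (nodes lvs) + 1"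
  using assms(7-)
proof (induction lvs)
  case (Cons lv lvs)
  let ?F = "set (nodes lvs)" and ?A = "set (nodes (lv # lvs))"
  have IH: "2 ^ length lvs \<le> length (nodes lvs) + 1" using Cons by auto
  have cA: "card ?A = length (nodes (lv # lvs))" and cF: "card ?F = length (nodes lvs)"
    using distinct_card[of "nodes (lv # lvs)"] distinct_card[of "nodes lvs"] Cons.prems(2)
    by (simp_all del: set_map set_concat)
  show ?case
  proof (cases lvs)
    \<comment> \<open>The halving lemma needs a node that is passed on. The last level is counted
      directly: it is not empty, and 2 is at most its size plus 1.\<close>
    case Nil
    then show ?thesis using Cons.prems by (cases lv) auto
  next
    case (Cons lv' lvs')
    have "2 * card ?F < card ?A"
    proof (rule passed_on_less_half[OF G r eps nbs])
      show "card ?A \<le> K" using Cons.prems cA by simp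
      show "?F \<noteq> {}" using Cons Cons.prems by auto
    qed (use Cons.prems in auto)
    then show ?thesis using IH cA cF by simp
  qed
qed simp

text \<open>For \<open>t\<close> at least 2 there is room in \<open>2 ^ t \<le> K + 1\<close> to get
  \<open>2 ^ (t - 1) < K\<close>, so \<open>t - 1\<close> lies strictly below the logarithm and
  \<open>t\<close> is at most its ceiling. For \<open>t = 1\<close> and \<open>K = 1\<close> this
  fails, and the maximum with 1 steps in.\<close>

lemma le_ceiling_log2:
  fixes K t :: nat
  assumes "2 ^ t \<le> K + 1" "1 \<le> K"
  shows "t \<le> max 1 (nat \<lceil>log 2 (real K)\<rceil>)"
proof (cases "t \<le> 1")
  case False
  then obtain s where s: "t = Suc (Suc s)" by (metis One_nat_def not0_implies_Suc not_less_eq_eq le0)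
  have "(2::nat) ^ t = 4 * 2 ^ s" "(2::nat) ^ (t - 1) = 2 * 2 ^ s" "(1::nat) \<le> 2 ^ s"
    by (simp_all add: s)
  with assms(1) have "(2::nat) ^ (t - 1) < K" by linarith
  then have "(2::real) ^ (t - 1) < real K" by (metis of_nat_less_iff of_nat_numeral of_nat_power)
  then have "real (t - 1) < log 2 (real K)"
    using assms(2) by (simp add: less_log_iff powr_realpow del: One_nat_def)
  then have "int (t - 1) < \<lceil>log 2 (real K)\<rceil>" by (simp add: less_ceiling_iff)
  then show ?thesis using s by linarith
qed simp

text \<open>The enumeration \<open>nbs\<close> of the neighbours is arbitrary but fixed for all
  lists \<open>S\<close>. The existence part takes any enumeration, the algorithmic part the one
  that its program produces.\<close>

lemma online_matching_levels_of:
  assumes G: "bipartite G" "left_degree G D" "bounded_right_degree G D r K \<epsilon>"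
    and r: "1 \<le> r" and K: "1 \<le> K" and eps: "0 < \<epsilon>"
    and nbs: "\<And>x. x \<in> left G \<Longrightarrow> mset (nbs x) = neighbors G x"
  defines "l \<equiv> nat \<lceil>(1 - 4 * \<epsilon>) * real D\<rceil>"
  shows "online_matching_fun G ((1 - 4 * \<epsilon>) * real D)
    (2 * max 1 (nat \<lceil>log 2 (real K)\<rceil>) * r) K
    (\<lambda>S x. mset (assigned (levels_of r l nbs S) x))"
proof -
  have l: "l \<le> length (nbs x)" if "x \<in> left G" for x
  proof -
    have "length (nbs x) = D"
      using G that nbs[OF that] unfolding left_degree_def neighbors_def
      by (metis size_image_mset size_mset)
    moreover have "(1 - 4 * \<epsilon>) * real D \<le> real D" using eps by (simp add: mult_left_le_one_le algebra_simps)
    ultimately show ?thesis unfolding l_def by linarith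
  qed
  have inv: "legal r l nbs (levels_of r l nbs S)" "distinct (nodes (levels_of r l nbs S))"
    "set (nodes (levels_of r l nbs S)) = set S" if "set S \<subseteq> left G" for S
    by (rule levels_of_invariants[OF r]; use that l in blast)+
  have entry: "\<exists>ps. (x, ps) \<in> set (concat (levels_of r l nbs S))" if "set S \<subseteq> left G" "x \<in> set S" for x S
    using inv(3)[OF that(1)] that(2) by fastforce
  show ?thesis
    unfolding online_matching_fun_def
  proof (intro allI impI conjI ballI; elim conjE)
    fix S x assume S: "set S \<subseteq> left G" "length S \<le> K" and x: "x \<in> left G"
    let ?lvs = "levels_of r l nbs S"
    note inv = inv[OF S(1)]
    show "mset (assigned ?lvs x) \<subseteq># neighbors G x"
    proof (cases "x \<in> set S")
      case True
      then obtain ps where "(x, ps) \<in> set (concat ?lvs)" using entry S by blast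
      then show ?thesis
        using assigned_eq[OF inv(2)] legal_entry(1)[OF inv(1)] nbs[OF x] by metis
    next
      case False
      then show ?thesis using assigned_eq_Nil[of x ?lvs] inv(3) by simp
    qed
    show "mset (assigned ?lvs x) = {#}" if "x \<notin> set S"
      using assigned_eq_Nil[of x ?lvs] inv(3) that by simp
    show "(1 - 4 * \<epsilon>) * real D \<le> real (size (mset (assigned ?lvs x)))" if "x \<in> set S"
    proof -
      obtain ps where ps: "(x, ps) \<in> set (concat ?lvs)" using entry S \<open>x \<in> set S\<close> by blast
      have "l \<le> length ps" by (rule legal_entry(2)[OF inv(1) ps])
      then have "(1 - 4 * \<epsilon>) * real D \<le> real (length ps)" unfolding l_def by linarith
      then show ?thesis using assigned_eq[OF inv(2) ps] by simp
    qed
  next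
    fix S x S' assume S: "set S \<subseteq> left G" "x \<in> set S" and S': "set S' \<subseteq> left G" "prefix S S'"
    obtain T where T: "S' = S @ T" using S'(2) by (auto elim: prefixE)
    obtain ps where ps: "(x, ps) \<in> set (concat (levels_of r l nbs S))" using entry S by blast
    with levels_of_append_mono have "(x, ps) \<in> set (concat (levels_of r l nbs S'))"
      unfolding T by blast
    then show "mset (assigned (levels_of r l nbs S') x) = mset (assigned (levels_of r l nbs S) x)"
      using assigned_eq[OF inv(2)[OF S'(1)]] assigned_eq[OF inv(2)[OF S(1)] ps] by simp
  next
    fix S p assume S: "set S \<subseteq> left G" "length S \<le> K"
    let ?lvs = "levels_of r l nbs S"
    note inv = inv[OF S(1)]
    have "length (nodes ?lvs) = card (set S)"
      using distinct_card[OF inv(2)] inv(3) by simp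
    then have nodes: "length (nodes ?lvs) \<le> K" using S card_length[of S] by linarith
    have "2 ^ length ?lvs \<le> length (nodes ?lvs) + 1"
      using inv S nodes
      by (intro power_length_levels_le[OF G r eps nbs]) (simp_all add: l_def)
    then have len: "length ?lvs \<le> max 1 (nat \<lceil>log 2 (real K)\<rceil>)"
      using nodes K by (intro le_ceiling_log2) linarith+
    have "card {x \<in> set S. p \<in># mset (assigned ?lvs x)} \<le> load (concat ?lvs) p"
      using card_assigned_le[OF inv(2,3)] by simp
    also have "\<dots> \<le> length ?lvs * (2 * r)" by (rule legal_load[OF inv(1)])
    also have "\<dots> \<le> max 1 (nat \<lceil>log 2 (real K)\<rceil>) * (2 * r)" by (rule mult_right_mono[OF len]) simp
    finally show "card {x \<in> set S. p \<in># mset (assigned ?lvs x)} \<le>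
        2 * max 1 (nat \<lceil>log 2 (real K)\<rceil>) * r" by (simp add: ac_simps)
  qed
qed

subsection \<open>The assignment program\<close>

lemma reach_member:
  assumes p: "reach A m F (\<lambda>i. enc_bits (p i))"
    and qs: "reach A m F (\<lambda>i. enc_list enc_bits (qs i))"
    and "\<And>i. i \<in> A \<Longrightarrow> length (p i) \<le> m i" "\<And>i. i \<in> A \<Longrightarrow> length (qs i) \<le> m i"
  shows "reach A m F (\<lambda>i. enc_bool (p i \<in> set (qs i)))"
proof -
  have "reach A m F (\<lambda>i. enc_bool (\<exists>q\<in>set (qs i). p i = q))"
  proof (rule reach_Bex[OF qs assms(4)])
    fix F'
    let ?r = "reach {(i, k). i \<in> A \<and> k < length (qs i)} (\<lambda>j. m (fst j)) F'"
    assume env: "\<And>g. reach A m F g \<Longrightarrow> ?r (\<lambda>j. g (fst j))"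
      and q: "?r (\<lambda>j. enc_bits (qs (fst j) ! snd j))"
    show "?r (\<lambda>j. enc_bool (p (fst j) = qs (fst j) ! snd j))"
      by (rule reach_eq_bits[OF env[OF p] q]) (use assms(3) in auto)
  qed
  then show ?thesis by simp
qed

definition enc_entry :: "bool list \<times> bool list list \<Rightarrow> tree" where
  "enc_entry e = Node (enc_bits (fst e)) (enc_list enc_bits (snd e))"

lemma reach_entry:
  "reach A m F (\<lambda>i. enc_bits (x i)) \<Longrightarrow> reach A m F (\<lambda>i. enc_list enc_bits (ps i)) \<Longrightarrow>
    reach A m F (\<lambda>i. enc_entry (x i, ps i))"
  by (simp add: enc_entry_def reach_Node)

abbreviation enc_level :: "(bool list, bool list) level \<Rightarrow> tree" where
  "enc_level \<equiv> enc_list enc_entry"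

lemma reach_load:
  assumes lv: "reach A m F (\<lambda>i. enc_level (lv i))"
    and p: "reach A m F (\<lambda>i. enc_bits (p i))"
    and len: "\<And>i. i \<in> A \<Longrightarrow> length (lv i) \<le> m i" "\<And>i. i \<in> A \<Longrightarrow> length (p i) \<le> m i"
      "\<And>i e. i \<in> A \<Longrightarrow> e \<in> set (lv i) \<Longrightarrow> length (snd e) \<le> m i"
  shows "reach A m F (\<lambda>i. enc_nat (load (lv i) (p i)))"
proof -
  have "reach A m F (\<lambda>i. enc_level (rev (filter (\<lambda>e. p i \<in> set (snd e)) (lv i))))"
  proof (rule reach_filter[OF lv len(1)])
    fix F'
    let ?r = "reach {(i, k). i \<in> A \<and> k < length (lv i)} (\<lambda>j. m (fst j)) F'"
    assume env: "\<And>g. reach A m F g \<Longrightarrow> ?r (\<lambda>j. g (fst j))"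
      and e: "?r (\<lambda>j. enc_entry (lv (fst j) ! snd j))"
    show "?r (\<lambda>j. enc_bool (p (fst j) \<in> set (snd (lv (fst j) ! snd j))))"
      by (rule reach_member[OF env[OF p] reach_NodeD2[OF e[unfolded enc_entry_def]]])
        (auto intro!: len)
  qed
  then have "reach A m F (\<lambda>i. enc_nat (length (rev (filter (\<lambda>e. p i \<in> set (snd e)) (lv i)))))"
    by (rule reach_length) (auto intro: le_trans[OF length_filter_le len(1)])
  then show ?thesis by (simp add: load_def)
qed

lemma load_le_length: "load lv p \<le> length lv"
  by (simp add: load_def)

lemma reach_available:
  assumes r: "reach A m F (\<lambda>i. enc_nat (2 * r i))"
    and lv: "reach A m F (\<lambda>i. enc_level (lv i))"
    and ps: "reach A m F (\<lambda>i. enc_list enc_bits (ps i))"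
    and len: "\<And>i. i \<in> A \<Longrightarrow> length (lv i) \<le> m i"
      "\<And>i e. i \<in> A \<Longrightarrow> e \<in> set (lv i) \<Longrightarrow> length (snd e) \<le> m i"
      "\<And>i. i \<in> A \<Longrightarrow> length (ps i) \<le> m i"
      "\<And>i p. i \<in> A \<Longrightarrow> p \<in> set (ps i) \<Longrightarrow> length p \<le> m i"
  shows "reach A m F (\<lambda>i. enc_list enc_bits (available (r i) (lv i) (ps i)))"
  unfolding available_def
proof (rule reach_filter[OF ps len(3)])
  fix F'
  let ?r = "reach {(i, k). i \<in> A \<and> k < length (ps i)} (\<lambda>j. m (fst j)) F'"
  assume env: "\<And>g. reach A m F g \<Longrightarrow> ?r (\<lambda>j. g (fst j))"
    and p: "?r (\<lambda>j. enc_bits (ps (fst j) ! snd j))"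
  have load: "?r (\<lambda>j. enc_nat (load (lv (fst j)) (ps (fst j) ! snd j)))"
    by (rule reach_load[OF env[OF lv] p]) (use len in auto)
  show "?r (\<lambda>j. enc_bool (load (lv (fst j)) (ps (fst j) ! snd j) < 2 * r (fst j)))"
  proof (rule reach_less[OF load env[OF r]])
    fix j assume "j \<in> {(i, k). i \<in> A \<and> k < length (ps i)}"
    then have "length (lv (fst j)) \<le> m (fst j)" using len(1) by auto
    then show "length (bits (load (lv (fst j)) (ps (fst j) ! snd j))) \<le> m (fst j)"
      using length_bits_le load_le_length le_trans by metis
  qed
qed

text \<open>The recursion in \<open>place\<close> stops at the first level that takes the node,
  whereas a fold visits them all. This is the flag telling it that the remaining levels are merely
  copied.\<close>

definition accepted :: "nat \<Rightarrow> nat \<Rightarrow> 'b list \<Rightarrow> ('a, 'b) level list \<Rightarrow> bool" where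
  "accepted r l ps lvs \<longleftrightarrow> (\<exists>lv\<in>set lvs. l \<le> length (available r lv ps))"

lemma nth_place:
  "k < length lvs \<Longrightarrow> place r l x ps lvs ! k =
    (if accepted r l ps (take k lvs) \<or> length (available r (lvs ! k) ps) < l then lvs ! k
     else (x, available r (lvs ! k) ps) # lvs ! k)"
proof (induction lvs arbitrary: k)
  case (Cons lv lvs)
  then show ?case by (cases k) (auto simp: accepted_def)
qed simp

lemma length_place: "length lvs \<le> length (place r l x ps lvs)"
  by (induction lvs) auto

text \<open>Beyond the existing levels there is at most one new one, opened exactly if all of them
  refuse. With \<open>nth_place\<close> this describes the result position by position, as a fold
  produces it.\<close>

lemma drop_place:
  "drop (length lvs) (place r l x ps lvs) = (if accepted r l ps lvs then [] else [[(x, ps)]])"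
  by (induction lvs) (auto simp: accepted_def split: if_splits)

text \<open>One fold with the flag \<open>accepted\<close> rebuilds the levels backwards, a possible
  new level is added, and the list is reversed. The bound on the number of levels is strict to leave
  room for the new one.\<close>

lemma reach_place:
  assumes r: "reach A m F (\<lambda>i. enc_nat (2 * r i))" and l: "reach A m F (\<lambda>i. enc_nat (l i))"
    and x: "reach A m F (\<lambda>i. enc_bits (x i))"
    and ps: "reach A m F (\<lambda>i. enc_list enc_bits (ps i))"
    and lvs: "reach A m F (\<lambda>i. enc_list enc_level (lvs i))"
    and len: "\<And>i. i \<in> A \<Longrightarrow> length (lvs i) < m i"
      "\<And>i. i \<in> A \<Longrightarrow> length (concat (lvs i)) \<le> m i"
      "\<And>i e. i \<in> A \<Longrightarrow> e \<in> set (concat (lvs i)) \<Longrightarrow> length (snd e) \<le> m i"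
      "\<And>i. i \<in> A \<Longrightarrow> length (ps i) \<le> m i"
      "\<And>i p. i \<in> A \<Longrightarrow> p \<in> set (ps i) \<Longrightarrow> length p \<le> m i"
  shows "reach A m F (\<lambda>i. enc_list enc_level (place (r i) (l i) (x i) (ps i) (lvs i)))"
proof -
  let ?new = "\<lambda>i. place (r i) (l i) (x i) (ps i) (lvs i)"
  let ?c = "\<lambda>i k. accepted (r i) (l i) (ps i) (take k (lvs i))"
  let ?acc = "\<lambda>i k. Node (enc_bool (?c i k)) (enc_list enc_level (rev (take k (?new i))))"
  have "reach A m F (\<lambda>i. ?acc i (length (lvs i)))"
  proof (rule reach_fold[where acc = ?acc, OF lvs less_imp_le[OF len(1)]])
    show "reach A m F (\<lambda>i. ?acc i 0)"
      using reach_const[of A m F "Node (enc_bool False) Leaf"] by (simp add: accepted_def)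
    fix F'
    let ?B = "{(i, k). i \<in> A \<and> k < length (lvs i)}"
    let ?r = "reach ?B (\<lambda>j. m (fst j)) F'"
    assume env: "\<And>g. reach A m F g \<Longrightarrow> ?r (\<lambda>j. g (fst j))"
      and lv: "?r (\<lambda>j. enc_level (lvs (fst j) ! snd j))"
      and acc: "?r (\<lambda>j. ?acc (fst j) (snd j))"
    let ?lv = "\<lambda>j. lvs (fst j) ! snd j"
    let ?av = "\<lambda>j. available (r (fst j)) (?lv j) (ps (fst j))"
    have len_lv: "length (?lv j) \<le> m (fst j)" if "j \<in> ?B" for j
    proof -
      have "?lv j \<in> set (lvs (fst j))" using that by auto
      then have "length (?lv j) \<le> length (concat (lvs (fst j)))"
        by (auto simp: length_concat intro: member_le_sum_list)
      also have "\<dots> \<le> m (fst j)" using that by (intro len(2)) auto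
      finally show ?thesis .
    qed
    have av: "?r (\<lambda>j. enc_list enc_bits (?av j))"
    proof (rule reach_available[OF env[OF r] lv env[OF ps] len_lv])
      fix j e assume j: "j \<in> ?B" and e: "e \<in> set (?lv j)"
      then have "e \<in> set (concat (lvs (fst j)))" by (auto intro!: bexI[OF _ nth_mem])
      then show "length (snd e) \<le> m (fst j)" using j by (intro len(3)) auto
    qed (use len in auto)
    have len_av: "length (?av j) \<le> m (fst j)" if "j \<in> ?B" for j
      by (rule le_trans[OF length_available_le len(4)]) (use that in auto)
    have "?r (\<lambda>j. enc_nat (length (?av j)))"
      by (rule reach_length[OF av len_av])
    then have few: "?r (\<lambda>j. enc_bool (length (?av j) < l (fst j)))"
      by (rule reach_less[OF _ env[OF l]]) (rule le_trans[OF length_bits_le len_av])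
    have c: "?r (\<lambda>j. enc_bool (?c (fst j) (snd j)))" by (rule reach_NodeD1[OF acc])
    have e: "?r (\<lambda>j. enc_level ((x (fst j), ?av j) # ?lv j))"
      unfolding enc_list.simps by (rule reach_Node[OF reach_entry[OF env[OF x] av] lv])
    have "?r (\<lambda>j. if ?c (fst j) (snd j) \<or> length (?av j) < l (fst j)
        then enc_level (?lv j) else enc_level ((x (fst j), ?av j) # ?lv j))"
      by (rule reach_if[OF reach_disj[OF c few] _ reach_mono[OF lv] reach_mono[OF e]]) auto
    then have new: "?r (\<lambda>j. enc_level (?new (fst j) ! snd j))"
      by (rule reach_cong) (auto simp: nth_place)
    have 1: "?r (\<lambda>j. enc_list enc_level (rev (take (Suc (snd j)) (?new (fst j)))))"
    proof (rule reach_cong[OF reach_Node[OF new reach_NodeD2[OF acc]]])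
      fix j assume "j \<in> ?B"
      then have "snd j < length (?new (fst j))"
        by (intro less_le_trans[OF _ length_place]) auto
      then show "Node (enc_level (?new (fst j) ! snd j))
          (enc_list enc_level (rev (take (snd j) (?new (fst j))))) =
          enc_list enc_level (rev (take (Suc (snd j)) (?new (fst j))))"
        by (simp add: take_Suc_conv_app_nth)
    qed
    have "?r (\<lambda>j. enc_bool (?c (fst j) (snd j) \<or> \<not> length (?av j) < l (fst j)))"
      by (rule reach_disj[OF c reach_not[OF few]])
    then have "?r (\<lambda>j. enc_bool (?c (fst j) (Suc (snd j))))"
      by (rule reach_cong)
        (auto simp: accepted_def take_Suc_conv_app_nth not_less intro!: arg_cong[of _ _ enc_bool])
    then show "?r (\<lambda>j. ?acc (fst j) (Suc (snd j)))" by (rule reach_Node[OF _ 1])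
  qed
  note acc = reach_NodeD1[OF this] reach_NodeD2[OF this]
  let ?rest = "\<lambda>i. enc_list enc_level (rev (take (length (lvs i)) (?new i)))"
  have c: "reach A m F (\<lambda>i. enc_bool (accepted (r i) (l i) (ps i) (lvs i)))"
    using acc(1) by simp
  have e: "reach A m F (\<lambda>i. Node (enc_level [(x i, ps i)]) (?rest i))"
    unfolding enc_list.simps
    by (rule reach_Node[OF reach_Node[OF reach_entry[OF x ps] reach_Leaf] acc(2)])
  have "reach A m F (\<lambda>i. if accepted (r i) (l i) (ps i) (lvs i) then ?rest i
      else Node (enc_level [(x i, ps i)]) (?rest i))"
    by (rule reach_if[OF c _ reach_mono[OF acc(2)] reach_mono[OF e]]) auto
  then have new: "reach A m F (\<lambda>i. enc_list enc_level (rev (?new i)))"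
  proof (rule reach_cong)
    fix i
    have "rev (?new i) = rev (drop (length (lvs i)) (?new i)) @ rev (take (length (lvs i)) (?new i))"
      by (simp flip: rev_append)
    then show "(if accepted (r i) (l i) (ps i) (lvs i) then ?rest i
      else Node (enc_level [(x i, ps i)]) (?rest i)) = enc_list enc_level (rev (?new i))"
      by (simp add: drop_place)
  qed
  have "length (rev (?new i)) \<le> m i" if "i \<in> A" for i
  proof -
    have "length (drop (length (lvs i)) (?new i)) \<le> 1" by (simp only: drop_place) simp
    then show ?thesis using len(1)[OF that] by simp
  qed
  from reach_rev[OF new this] show ?thesis by simp
qed

text \<open>Nested loops need no rule of their own: the inner fold runs over instances that are
  themselves pairs of an instance and an outer round, with the measure still taken from the original
  instance.\<close>

lemma reach_rev_concat:
  assumes xss: "reach A m F (\<lambda>i. enc_list (enc_list enc) (xss i))"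
    and len: "\<And>i. i \<in> A \<Longrightarrow> length (xss i) \<le> m i"
      "\<And>i xs. i \<in> A \<Longrightarrow> xs \<in> set (xss i) \<Longrightarrow> length xs \<le> m i"
  shows "reach A m F (\<lambda>i. enc_list enc (rev (concat (xss i))))"
proof -
  let ?acc = "\<lambda>i k. enc_list enc (rev (concat (take k (xss i))))"
  have "reach A m F (\<lambda>i. ?acc i (length (xss i)))"
  proof (rule reach_fold[where acc = ?acc, OF xss len(1)])
    show "reach A m F (\<lambda>i. ?acc i 0)" by (simp add: reach_Leaf)
    fix F'
    let ?B = "{(i, k). i \<in> A \<and> k < length (xss i)}"
    let ?r = "reach ?B (\<lambda>j. m (fst j)) F'"
    assume xs: "?r (\<lambda>j. enc_list enc (xss (fst j) ! snd j))"
      and acc: "?r (\<lambda>j. ?acc (fst j) (snd j))"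
    let ?xs = "\<lambda>j. xss (fst j) ! snd j"
    let ?acc' = "\<lambda>j k. enc_list enc (rev (take k (?xs j)) @ rev (concat (take (snd j) (xss (fst j)))))"
    have "?r (\<lambda>j. ?acc' j (length (?xs j)))"
    proof (rule reach_fold[where acc = ?acc', OF xs])
      show "length (?xs j) \<le> m (fst j)" if "j \<in> ?B" for j
        using that len(2) by auto
      show "?r (\<lambda>j. ?acc' j 0)" using acc by simp
      fix F''
      let ?r' = "reach {(j, k). j \<in> ?B \<and> k < length (?xs j)} (\<lambda>j'. m (fst (fst j'))) F''"
      assume "?r' (\<lambda>j'. enc (?xs (fst j') ! snd j'))" "?r' (\<lambda>j'. ?acc' (fst j') (snd j'))"
      then show "?r' (\<lambda>j'. ?acc' (fst j') (Suc (snd j')))"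
        by (rule reach_cong[OF reach_Node]) (auto simp: take_Suc_conv_app_nth)
    qed
    then show "?r (\<lambda>j. ?acc (fst j) (Suc (snd j)))"
      by (rule reach_cong) (auto simp: take_Suc_conv_app_nth)
  qed
  then show ?thesis by simp
qed

text \<open>Flattening and filtering each reverse the list, so the original order returns and the
  first match is the one that \<open>map_of\<close> selects.\<close>

lemma reach_entries:
  assumes lvs: "reach A m F (\<lambda>i. enc_list enc_level (lvs i))"
    and x: "reach A m F (\<lambda>i. enc_bits (x i))"
    and len: "\<And>i. i \<in> A \<Longrightarrow> length (lvs i) \<le> m i"
      "\<And>i. i \<in> A \<Longrightarrow> length (concat (lvs i)) \<le> m i"
      "\<And>i. i \<in> A \<Longrightarrow> length (x i) \<le> m i"
  shows "reach A m F (\<lambda>i. enc_level (filter (\<lambda>e. x i = fst e) (concat (lvs i))))"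
proof -
  have len_lv: "length lv \<le> m i" if "i \<in> A" "lv \<in> set (lvs i)" for i lv
  proof -
    have "length lv \<le> length (concat (lvs i))"
      using that by (auto simp: length_concat intro: member_le_sum_list)
    then show ?thesis using len(2)[OF that(1)] by simp
  qed
  have es: "reach A m F (\<lambda>i. enc_level (rev (concat (lvs i))))"
    by (rule reach_rev_concat[OF lvs len(1) len_lv])
  have "reach A m F (\<lambda>i. enc_level (rev (filter (\<lambda>e. x i = fst e) (rev (concat (lvs i))))))"
  proof (rule reach_filter[OF es])
    show "length (rev (concat (lvs i))) \<le> m i" if "i \<in> A" for i using len(2)[OF that] by simp
    fix F'
    let ?r = "reach {(i, k). i \<in> A \<and> k < length (rev (concat (lvs i)))} (\<lambda>j. m (fst j)) F'"
    assume env: "\<And>g. reach A m F g \<Longrightarrow> ?r (\<lambda>j. g (fst j))"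
      and e: "?r (\<lambda>j. enc_entry (rev (concat (lvs (fst j))) ! snd j))"
    show "?r (\<lambda>j. enc_bool (x (fst j) = fst (rev (concat (lvs (fst j))) ! snd j)))"
      by (rule reach_eq_bits[OF env[OF x] reach_NodeD1[OF e[unfolded enc_entry_def]]])
        (use len(3) in auto)
  qed
  then show ?thesis by (simp only: rev_filter rev_rev_ident)
qed

lemma map_of_eq_filter:
  "map_of es x = (case filter (\<lambda>e. x = fst e) es of [] \<Rightarrow> None | e # _ \<Rightarrow> Some (snd e))"
  by (induction es) auto

text \<open>\<open>head\<close> and \<open>tail\<close> send \<open>Leaf\<close> to
  \<open>Leaf\<close>, which is also the code of \<open>[]\<close>. A node without an entry thus
  gets its default without a test.\<close>

lemma reach_assigned:
  assumes "reach A m F (\<lambda>i. enc_list enc_level (lvs i))"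
    and "reach A m F (\<lambda>i. enc_bits (x i))"
    and "\<And>i. i \<in> A \<Longrightarrow> length (lvs i) \<le> m i"
      "\<And>i. i \<in> A \<Longrightarrow> length (concat (lvs i)) \<le> m i"
      "\<And>i. i \<in> A \<Longrightarrow> length (x i) \<le> m i"
  shows "reach A m F (\<lambda>i. enc_list enc_bits (assigned (lvs i) (x i)))"
proof (rule reach_cong[OF reach_tail[OF reach_head[OF reach_entries[OF assms]]]])
  fix i
  show "tail (head (enc_level (filter (\<lambda>e. x i = fst e) (concat (lvs i))))) =
      enc_list enc_bits (assigned (lvs i) (x i))"
    unfolding assigned_def map_of_eq_filter
    by (cases "filter (\<lambda>e. x i = fst e) (concat (lvs i))") (auto simp: enc_entry_def)
qed

lemma reach_insert_node:
  assumes r: "reach A m F (\<lambda>i. enc_nat (2 * r i))" and l: "reach A m F (\<lambda>i. enc_nat (l i))"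
    and x: "reach A m F (\<lambda>i. enc_bits (x i))"
    and ps: "reach A m F (\<lambda>i. enc_list enc_bits (nbs i (x i)))"
    and lvs: "reach A m F (\<lambda>i. enc_list enc_level (lvs i))"
    and len: "\<And>i. i \<in> A \<Longrightarrow> length (lvs i) < m i"
      "\<And>i. i \<in> A \<Longrightarrow> length (concat (lvs i)) \<le> m i"
      "\<And>i e. i \<in> A \<Longrightarrow> e \<in> set (concat (lvs i)) \<Longrightarrow> length (snd e) \<le> m i"
      "\<And>i. i \<in> A \<Longrightarrow> length (nbs i (x i)) \<le> m i"
      "\<And>i p. i \<in> A \<Longrightarrow> p \<in> set (nbs i (x i)) \<Longrightarrow> length p \<le> m i"
    and lx: "\<And>i. i \<in> A \<Longrightarrow> length (x i) \<le> m i"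
  shows "reach A m F (\<lambda>i. enc_list enc_level (insert_node (r i) (l i) (nbs i) (lvs i) (x i)))"
proof -
  have "reach A m F (\<lambda>i. enc_bool (filter (\<lambda>e. x i = fst e) (concat (lvs i)) \<noteq> []))"
    by (rule reach_nonempty[OF reach_entries[OF lvs x less_imp_le[OF len(1)] len(2) lx]])
  then have "reach A m F (\<lambda>i. if x i \<in> set (nodes (lvs i)) then enc_list enc_level (lvs i)
      else enc_list enc_level (place (r i) (l i) (x i) (nbs i (x i)) (lvs i)))"
    by (rule reach_if[OF _ _ reach_mono[OF lvs] reach_mono[OF reach_place[OF r l x ps lvs len]]])
      (auto simp: filter_empty_conv simp del: set_concat)
  then show ?thesis
    by (rule reach_cong) (auto simp: insert_node_def simp del: set_map set_concat)
qed

text \<open>Only the number \<open>D\<close> is given and no list to fold over, so the loop counts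
  in binary and compares its counter with \<open>D\<close>. Round \<open>k\<close> asks for
  neighbour \<open>Suc k\<close>, since neighbours are numbered from 1.\<close>

lemma reach_neighbors:
  assumes Q: "\<And>n x k. n \<in> I \<Longrightarrow> x \<in> left (G n) \<Longrightarrow> k \<in> {1..D n} \<Longrightarrow>
      computes_within Q (Node (enc_bits x) (enc_nat k)) (enc_bits (nb n x k)) (poly q n)"
    and x: "reach A m F (\<lambda>i. enc_bits (x i))" and D: "reach A m F (\<lambda>i. enc_nat (D (n i)))"
    and dom: "\<And>i. i \<in> A \<Longrightarrow> n i \<in> I" "\<And>i. i \<in> A \<Longrightarrow> x i \<in> left (G (n i))"
    and len: "\<And>i. i \<in> A \<Longrightarrow> n i \<le> m i" "\<And>i. i \<in> A \<Longrightarrow> D (n i) \<le> m i"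
  shows "reach A m F (\<lambda>i. enc_list enc_bits (rev (map (nb (n i) (x i)) [1..<Suc (D (n i))])))"
proof -
  let ?out = "\<lambda>i k. enc_list enc_bits (rev (map (nb (n i) (x i)) [1..<Suc k]))"
  have "reach A m F (\<lambda>i. Node (enc_nat (D (n i))) (?out i (D (n i))))"
  proof (rule reach_iterate[where acc = "\<lambda>i k. Node (enc_nat k) (?out i k)"
        and N = "\<lambda>i. D (n i)" and b = "\<lambda>i k. enc_bool (k < D (n i))"])
    show "reach A m F (\<lambda>i. Node (enc_nat 0) (?out i 0))"
      by (simp add: reach_const)
  next
    fix F'
    let ?r = "reach {(i, k). i \<in> A \<and> k \<le> D (n i)} (\<lambda>j. m (fst j)) F'"
    assume env: "\<And>g. reach A m F g \<Longrightarrow> ?r (\<lambda>j. g (fst j))"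
      and acc: "?r (\<lambda>j. Node (enc_nat (snd j)) (?out (fst j) (snd j)))"
    show "?r (\<lambda>j. enc_bool (snd j < D (n (fst j))))"
    proof (rule reach_less[OF reach_NodeD1[OF acc] env[OF D]])
      fix j assume "j \<in> {(i, k). i \<in> A \<and> k \<le> D (n i)}"
      then have "snd j \<le> m (fst j)" using len(2)[of "fst j"] by auto
      then show "length (bits (snd j)) \<le> m (fst j)" using length_bits_le le_trans by blast
    qed
  next
    fix F'
    let ?B = "{(i, k). i \<in> A \<and> k < D (n i)}"
    let ?r = "reach ?B (\<lambda>j. m (fst j)) F'"
    assume env: "\<And>g. reach A m F g \<Longrightarrow> ?r (\<lambda>j. g (fst j))"
      and acc: "?r (\<lambda>j. Node (enc_nat (snd j)) (?out (fst j) (snd j)))"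
    have S: "?r (\<lambda>j. enc_nat (Suc (snd j)))"
    proof (rule reach_Suc[OF reach_NodeD1[OF acc]])
      fix j assume "j \<in> ?B"
      then show "Suc (snd j) \<le> m (fst j)" using len(2)[of "fst j"] by auto
    qed
    \<comment> \<open>The given program enters as a plain reachability fact, started on exactly the
      pair that it expects.\<close>
    have "reach ?B (\<lambda>j. m (fst j)) (\<lambda>j. Node (enc_bits (x (fst j))) (enc_nat (Suc (snd j))))
        (\<lambda>j. enc_bits (nb (n (fst j)) (x (fst j)) (Suc (snd j))))"
      unfolding reach_def
    proof (intro exI[of _ Q] exI[of _ q] ballI)
      fix j assume j: "j \<in> ?B"
      have "computes_within Q (Node (enc_bits (x (fst j))) (enc_nat (Suc (snd j))))
          (enc_bits (nb (n (fst j)) (x (fst j)) (Suc (snd j)))) (poly q (n (fst j)))"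
        using j by (intro Q dom) auto
      moreover have "poly q (n (fst j)) \<le> poly q (m (fst j))"
        using j by (intro poly_nat_mono len) auto
      ultimately show "computes_within Q (Node (enc_bits (x (fst j))) (enc_nat (Suc (snd j))))
          (enc_bits (nb (n (fst j)) (x (fst j)) (Suc (snd j)))) (poly q (m (fst j)))"
        unfolding computes_within_def by (meson le_trans)
    qed
    then have nb: "?r (\<lambda>j. enc_bits (nb (n (fst j)) (x (fst j)) (Suc (snd j))))"
      by (rule reach_comp[OF reach_Node[OF env[OF x] S]])
    have "?r (\<lambda>j. ?out (fst j) (Suc (snd j)))"
      by (rule reach_cong[OF reach_Node[OF nb reach_NodeD2[OF acc]]]) simp
    then show "?r (\<lambda>j. Node (enc_nat (Suc (snd j))) (?out (fst j) (Suc (snd j))))"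
      by (rule reach_Node[OF S])
  qed (use len in auto)
  then show ?thesis by (rule reach_NodeD2)
qed

section \<open>Tree height and the length of outputs\<close>

fun height :: "tree \<Rightarrow> nat" where
  "height Leaf = 0"
| "height (Node a b) = Suc (max (height a) (height b))"

lemma height_head: "height (head t) \<le> height t" and height_tail: "height (tail t) \<le> height t"
  by (cases t; simp)+

lemma height_val: "(\<And>v. height (s v) \<le> h) \<Longrightarrow> height (val e s) \<le> h + cost e"
proof (induction e)
  case (EHd e)
  then show ?case using height_head[of "val e s"] by (simp add: le_SucI le_trans)
next
  case (ETl e)
  then show ?case using height_tail[of "val e s"] by (simp add: le_SucI le_trans)
qed (auto intro: le_trans simp: le_SucI trans_le_add1 trans_le_add2)

text \<open>Sharing allows trees of size exponential in the running time, but their height grows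
  at most by the running time.\<close>

lemma height_exec: "exec c s t s' \<Longrightarrow> (\<And>v. height (s v) \<le> h) \<Longrightarrow> height (s' v) \<le> h + t"
proof (induction arbitrary: h v rule: exec.induct)
  case (Assign w e s)
  then show ?case using height_val[OF Assign] by (simp add: le_SucI trans_le_add1)
next
  case (Seq c1 s1 t1 s2 c2 t2 s3)
  then show ?case by (metis add.assoc)
next
  case (IfTrue e s c1 t s' c2)
  then show ?case by (metis add.left_commute trans_le_add2)
next
  case (IfFalse e s c2 t s' c1)
  then show ?case by (metis add.left_commute trans_le_add2)
next
  case (WhileTrue e s1 c t1 s2 t2 s3)
  have "height (s3 v) \<le> (h + t1) + t2" using WhileTrue by blast
  then show ?case by simp
next
  case (Skip s)
  then show ?case by (intro trans_le_add1)
next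
  case (WhileFalse e s c)
  then show ?case by (intro trans_le_add1)
qed

lemma length_le_height: "length xs \<le> height (enc_list enc xs)"
  by (induction xs) auto

lemma height_enc_bits: "height (enc_bits bs) \<le> Suc (length bs)"
  by (induction bs) (auto simp: enc_bool_def)

text \<open>A list of length \<open>n\<close> has height at least \<open>n\<close>, and height grows
  by at most the time spent. This bounds the names of right nodes, for which an explicit family
  promises no length.\<close>

lemma length_output_le:
  assumes "computes_within P input (enc_list enc ys) T"
  shows "length ys \<le> height input + T"
proof -
  obtain t s where t: "t \<le> T" and ex: "exec P ((\<lambda>_. Leaf)(0 := input)) t s"
    and s: "s 0 = enc_list enc ys"
    using assms unfolding computes_within_def by blast
  have "height (s 0) \<le> height input + t" by (rule height_exec[OF ex]) simp
  then show ?thesis using t s length_le_height[of ys enc] by simp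
qed

lemma reach_levels_of:
  assumes Q: "\<And>n x k. n \<in> I \<Longrightarrow> x \<in> left (G n) \<Longrightarrow> k \<in> {1..D n} \<Longrightarrow>
      computes_within Q (Node (enc_bits x) (enc_nat k)) (enc_bits (nb n x k)) (poly q n)"
    and D: "reach A m F (\<lambda>i. enc_nat (D (n i)))" and r: "reach A m F (\<lambda>i. enc_nat (r i))"
    and l: "reach A m F (\<lambda>i. enc_nat (l i))"
    and S: "reach A m F (\<lambda>i. enc_list enc_bits (S i))"
    and dom: "\<And>i. i \<in> A \<Longrightarrow> n i \<in> I" "\<And>i. i \<in> A \<Longrightarrow> set (S i) \<subseteq> left (G (n i))"
      "\<And>i. i \<in> A \<Longrightarrow> 1 \<le> r i" "\<And>i. i \<in> A \<Longrightarrow> l i \<le> D (n i)"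
    and len: "\<And>i. i \<in> A \<Longrightarrow> n i \<le> m i" "\<And>i. i \<in> A \<Longrightarrow> D (n i) \<le> m i"
      "\<And>i. i \<in> A \<Longrightarrow> length (S i) \<le> m i"
      "\<And>i y. i \<in> A \<Longrightarrow> y \<in> left (G (n i)) \<Longrightarrow> length y \<le> m i"
      "\<And>i y k. i \<in> A \<Longrightarrow> y \<in> left (G (n i)) \<Longrightarrow> k \<in> {1..D (n i)} \<Longrightarrow>
        length (nb (n i) y k) \<le> m i"
  defines "nbs \<equiv> \<lambda>n x. rev (map (nb n x) [1..<Suc (D n)])"
  shows "reach A m F (\<lambda>i. enc_list enc_level (levels_of (r i) (l i) (nbs (n i)) (S i)))"
proof -
  \<comment> \<open>With the least significant bit first, doubling puts a zero bit, coded by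
    \<open>Leaf\<close>, in front. This needs \<open>1 \<le> r\<close>: the code of 0 has no bits at
    all.\<close>
  have r2: "reach A m F (\<lambda>i. enc_nat (2 * r i))"
    by (rule reach_cong[OF reach_Node[OF reach_Leaf r]])
      (use dom(3) in \<open>force simp: bits_pos enc_bool_def\<close>)
  let ?acc = "\<lambda>i k. levels_of (r i) (l i) (nbs (n i)) (take k (S i))"
  have "reach A m F (\<lambda>i. enc_list enc_level (?acc i (length (S i))))"
  proof (rule reach_fold[where acc = "\<lambda>i k. enc_list enc_level (?acc i k)", OF S len(3)])
    show "reach A m F (\<lambda>i. enc_list enc_level (?acc i 0))"
      by (simp add: levels_of_def reach_Leaf)
    fix F'
    let ?B = "{(i, k). i \<in> A \<and> k < length (S i)}"
    let ?r = "reach ?B (\<lambda>j. m (fst j)) F'"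
    assume env: "\<And>g. reach A m F g \<Longrightarrow> ?r (\<lambda>j. g (fst j))"
      and x: "?r (\<lambda>j. enc_bits (S (fst j) ! snd j))"
      and acc: "?r (\<lambda>j. enc_list enc_level (?acc (fst j) (snd j)))"
    let ?x = "\<lambda>j. S (fst j) ! snd j"
    have xL: "?x j \<in> left (G (n (fst j)))" if "j \<in> ?B" for j
      using that dom(2)[of "fst j"] by (auto simp: subset_iff)
    have nbs: "?r (\<lambda>j. enc_list enc_bits (nbs (n (fst j)) (?x j)))"
      unfolding nbs_def
      by (rule reach_neighbors[where G = G and I = I and Q = Q and q = q and D = D and nb = nb
            and n = "\<lambda>j. n (fst j)" and x = ?x, OF Q x env[OF D]])
        (auto intro!: dom len xL)
    have l_nbs: "l i \<le> length (nbs (n i) y)" if "i \<in> A" for i y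
      using dom(4)[OF that] by (simp add: nbs_def)
    note size = levels_of_size[OF dom(3) l_nbs]
    have "?r (\<lambda>j. enc_list enc_level (insert_node (r (fst j)) (l (fst j)) (nbs (n (fst j)))
        (?acc (fst j) (snd j)) (?x j)))"
    proof (rule reach_insert_node[where nbs = "\<lambda>j. nbs (n (fst j))" and x = ?x, OF env[OF r2] env[OF l] x nbs acc])
      fix j assume j: "j \<in> ?B"
      then have i: "fst j \<in> A" and k: "snd j < m (fst j)"
        using len(3)[of "fst j"] by auto
      \<comment> \<open>Before round \<open>k\<close> there are at most \<open>k\<close> levels, and
        \<open>k\<close> is below the length of \<open>S\<close>; this gives the strict bound that
        allows one more level to be opened.\<close>
      show "length (?acc (fst j) (snd j)) < m (fst j)"
        by (rule le_less_trans[OF size(2)[OF i i] le_less_trans[OF _ k]]) simp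
      show "length (concat (?acc (fst j) (snd j))) \<le> m (fst j)"
        by (rule le_trans[OF size(1)[OF i i] le_trans[OF _ less_imp_le[OF k]]]) simp
      show "length (snd e) \<le> m (fst j)" if "e \<in> set (concat (?acc (fst j) (snd j)))" for e
        using size(3)[OF i i that] len(2)[OF i] by (simp add: nbs_def del: upt_Suc)
      show "length (nbs (n (fst j)) (?x j)) \<le> m (fst j)"
        using len(2)[OF i] by (simp add: nbs_def)
      show "length p \<le> m (fst j)" if "p \<in> set (nbs (n (fst j)) (?x j))" for p
        using that len(5)[OF i xL[OF j]] by (auto simp: nbs_def less_Suc_eq_le)
      show "length (?x j) \<le> m (fst j)" by (rule len(4)[OF i xL[OF j]])
    qed
    then show "?r (\<lambda>j. enc_list enc_level (?acc (fst j) (Suc (snd j))))"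
      by (rule reach_cong) (auto simp: take_Suc_conv_app_nth levels_of_snoc)
  qed
  then show ?thesis by simp
qed

lemma reach_matching:
  assumes Q: "\<And>n x k. n \<in> I \<Longrightarrow> x \<in> left (G n) \<Longrightarrow> k \<in> {1..D n} \<Longrightarrow>
      computes_within Q (Node (enc_bits x) (enc_nat k)) (enc_bits (nb n x k)) (poly q n)"
    and left: "\<And>n x. n \<in> I \<Longrightarrow> x \<in> left (G n) \<Longrightarrow> length x = n"
    and dom: "\<And>i. i \<in> A \<Longrightarrow> n i \<in> I" "\<And>i. i \<in> A \<Longrightarrow> set (S i) \<subseteq> left (G (n i))"
      "\<And>i. i \<in> A \<Longrightarrow> 1 \<le> r i" "\<And>i. i \<in> A \<Longrightarrow> l i \<le> D (n i)"
      "\<And>i. i \<in> A \<Longrightarrow> length (S i) \<le> K i" "\<And>i. i \<in> A \<Longrightarrow> x i \<in> left (G (n i))"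
  defines "nbs \<equiv> \<lambda>n x. rev (map (nb n x) [1..<Suc (D n)])"
  shows "reach A (\<lambda>i. K i + D (n i) + n i)
    (\<lambda>i. matching_input (K i) (D (n i)) (r i) (l i) (S i) (x i))
    (\<lambda>i. enc_list enc_bits (assigned (levels_of (r i) (l i) (nbs (n i)) (S i)) (x i)))"
proof -
  let ?m = "\<lambda>i. K i + D (n i) + n i"
  \<comment> \<open>\<open>q\<close> covers the running time of the neighbour program and
    \<open>[:2, 1:]\<close> the height of its input, which exceeds the maximum of \<open>n\<close>
    and \<open>D\<close> by at most 2. In the end \<open>reach_poly\<close> returns to the measure
    \<open>K + D + n\<close>.\<close>
  let ?M = "\<lambda>i. poly (q + [:2, 1:]) (?m i)"
  let ?F = "\<lambda>i. matching_input (K i) (D (n i)) (r i) (l i) (S i) (x i)"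
  have 1: "reach A ?M ?F ?F" by (rule reach_id)
  note 2 = reach_NodeD2[OF 1[unfolded matching_input_def], folded matching_input_def]
  note 3 = reach_NodeD2[OF 2]
  note 4 = reach_NodeD2[OF 3]
  note 5 = reach_NodeD2[OF 4]
  have "reach A ?M ?F (\<lambda>i. enc_list enc_level (levels_of (r i) (l i) (nbs (n i)) (S i)))"
    unfolding nbs_def
  proof (rule reach_levels_of[where G = G and I = I and Q = Q and q = q and D = D and nb = nb
          and n = n and r = r and l = l and S = S, OF Q reach_NodeD1[OF 2] reach_NodeD1[OF 3]
          reach_NodeD1[OF 4] reach_NodeD1[OF 5]])
    fix i y k assume i: "i \<in> A" and y: "y \<in> left (G (n i))" and k: "k \<in> {1..D (n i)}"
    have "length (nb (n i) y k) \<le> height (Node (enc_bits y) (enc_nat k)) + poly q (n i)"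
      by (rule length_output_le[OF Q[OF dom(1)[OF i] y k]])
    moreover have "poly q (n i) \<le> poly q (?m i)" by (rule poly_nat_mono) simp
    moreover have "height (enc_bits y) \<le> Suc (n i)"
      using height_enc_bits[of y] left[OF dom(1)[OF i] y] by simp
    moreover have "height (enc_nat k) \<le> Suc (D (n i))"
      using height_enc_bits[of "bits k"] length_bits_le[of k] k by simp
    ultimately show "length (nb (n i) y k) \<le> ?M i" by simp
  next
    fix i assume i: "i \<in> A"
    show "length (S i) \<le> ?M i" using dom(5)[OF i] by simp
    show "length y \<le> ?M i" if "y \<in> left (G (n i))" for y
      using left[OF dom(1)[OF i] that] by simp
  qed (use dom in auto)
  then have "reach A ?M ?F
      (\<lambda>i. enc_list enc_bits (assigned (levels_of (r i) (l i) (nbs (n i)) (S i)) (x i)))"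
  proof (rule reach_assigned[OF _ reach_NodeD2[OF 5]])
    fix i assume i: "i \<in> A"
    have "l i \<le> length (nbs (n i) y)" for y
      using dom(4)[OF i] by (simp add: nbs_def)
    note size = levels_of_size[of "r i" "S i" "l i" "nbs (n i)", OF dom(3)[OF i] this]
    have "length (S i) \<le> ?M i" using dom(5)[OF i] by simp
    then show "length (levels_of (r i) (l i) (nbs (n i)) (S i)) \<le> ?M i"
      and "length (concat (levels_of (r i) (l i) (nbs (n i)) (S i))) \<le> ?M i"
      using size(1,2) by (blast intro: le_trans)+
    show "length (x i) \<le> ?M i" using left[OF dom(1)[OF i] dom(6)[OF i]] by simp
  qed
  then show ?thesis by (rule reach_poly)
qed

lemma matching_program:
  assumes "explicit_family I G D"
  obtains P and q :: "nat poly" and nbs where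
    "\<And>n x. n \<in> I \<Longrightarrow> x \<in> left (G n) \<Longrightarrow> mset (nbs n x) = neighbors (G n) x"
    "\<And>n r K l S x. n \<in> I \<Longrightarrow> 1 \<le> r \<Longrightarrow> l \<le> D n \<Longrightarrow> set S \<subseteq> left (G n) \<Longrightarrow>
      length S \<le> K \<Longrightarrow> x \<in> left (G n) \<Longrightarrow>
      computes_multiset_within P (matching_input K (D n) r l S x)
        (mset (assigned (levels_of r l (nbs n) S) x)) (poly q (K + D n + n))"
proof -
  obtain Q nb and q :: "nat poly"
    where nb: "\<And>n x. n \<in> I \<Longrightarrow> x \<in> left (G n) \<Longrightarrow>
        image_mset (nb n x) (mset_set {1..D n}) = neighbors (G n) x"
      and Q: "\<And>n x k. n \<in> I \<Longrightarrow> x \<in> left (G n) \<Longrightarrow> k \<in> {1..D n} \<Longrightarrow>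
        computes_within Q (Node (enc_bits x) (enc_nat k)) (enc_bits (nb n x k)) (poly q n)"
    using assms unfolding explicit_family_def by blast
  have left: "length x = n" if "n \<in> I" "x \<in> left (G n)" for n x
    using assms that unfolding explicit_family_def by blast
  define nbs where "nbs n x = rev (map (nb n x) [1..<Suc (D n)])" for n x
  \<comment> \<open>The index of the graph is part of the instance, so one program and one
    polynomial serve the whole family. The real number \<open>\<epsilon>\<close> is represented only
    by \<open>l\<close>.\<close>
  let ?A = "{(n, r, K, l, S, x). n \<in> I \<and> 1 \<le> r \<and> l \<le> D n \<and> set S \<subseteq> left (G n) \<and>
    length S \<le> K \<and> x \<in> left (G n)}"
  let ?n = fst and ?r = "\<lambda>i. fst (snd i)" and ?K = "\<lambda>i. fst (snd (snd i))"
    and ?l = "\<lambda>i. fst (snd (snd (snd i)))" and ?S = "\<lambda>i. fst (snd (snd (snd (snd i))))"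
    and ?x = "\<lambda>i. snd (snd (snd (snd (snd i))))"
  have "reach ?A (\<lambda>i. ?K i + D (?n i) + ?n i)
      (\<lambda>i. matching_input (?K i) (D (?n i)) (?r i) (?l i) (?S i) (?x i))
      (\<lambda>i. enc_list enc_bits (assigned (levels_of (?r i) (?l i)
        (\<lambda>x. rev (map (nb (?n i) x) [1..<Suc (D (?n i))])) (?S i)) (?x i)))"
    by (rule reach_matching[where I = I and G = G and Q = Q and q = q and D = D and nb = nb
          and n = ?n and r = ?r and K = ?K and l = ?l and S = ?S and x = ?x, OF Q left]) auto
  then obtain P p where P: "\<And>i. i \<in> ?A \<Longrightarrow> computes_within P
      (matching_input (?K i) (D (?n i)) (?r i) (?l i) (?S i) (?x i))
      (enc_list enc_bits (assigned (levels_of (?r i) (?l i)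
        (\<lambda>x. rev (map (nb (?n i) x) [1..<Suc (D (?n i))])) (?S i)) (?x i)))
      (poly p (?K i + D (?n i) + ?n i))"
    unfolding reach_def by blast
  show thesis
  proof (rule that[of nbs P p])
    fix n x assume "n \<in> I" "x \<in> left (G n)"
    have "mset (nbs n x) = image_mset (nb n x) (mset_set {1..D n})"
      by (simp add: nbs_def atLeastLessThanSuc_atLeastAtMost del: upt_Suc)
    then show "mset (nbs n x) = neighbors (G n) x" using nb \<open>n \<in> I\<close> \<open>x \<in> left (G n)\<close> by simp
  next
    fix n r K l :: nat and S x
    assume "n \<in> I" "1 \<le> r" "l \<le> D n" "set S \<subseteq> left (G n)" "length S \<le> K" "x \<in> left (G n)"
    then show "computes_multiset_within P (matching_input K (D n) r l S x)
        (mset (assigned (levels_of r l (nbs n) S) x)) (poly p (K + D n + n))"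
      using P[of "(n, r, K, l, S, x)"]
      unfolding computes_multiset_within_def nbs_def by auto
  qed
qed

theorem theorem2p5:
  shows
    "(\<forall>(G :: ('a, 'b) bigraph) (D :: nat) (r :: nat) (K :: nat) (\<epsilon> :: real).
        bipartite G \<and> left_degree G D \<and> 1 \<le> r \<and> 1 \<le> K \<and> 0 < \<epsilon> \<and>
        bounded_right_degree G D r K \<epsilon> \<longrightarrow>
        admits_online_matching G ((1 - 4 * \<epsilon>) * real D)
          (2 * max 1 (nat \<lceil>log 2 (real K)\<rceil>) * r) K)
     \<and>
     (\<forall>(I :: nat set) (G :: nat \<Rightarrow> (bool list, bool list) bigraph) (D :: nat \<Rightarrow> nat).
        explicit_family I G D \<longrightarrow>
        (\<exists>(P :: com) (q :: nat poly).
           \<forall>n\<in>I. \<forall>(r :: nat) (K :: nat) (\<epsilon> :: real).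
             1 \<le> r \<and> 1 \<le> K \<and> 0 < \<epsilon> \<and> bounded_right_degree (G n) (D n) r K \<epsilon> \<longrightarrow>
             (\<exists>f. online_matching_fun (G n) ((1 - 4 * \<epsilon>) * real (D n))
                    (2 * max 1 (nat \<lceil>log 2 (real K)\<rceil>) * r) K f \<and>
                  (\<forall>S. set S \<subseteq> left (G n) \<and> length S \<le> K \<longrightarrow>
                     (\<forall>x\<in>left (G n).
                        computes_multiset_within P
                          (matching_input K (D n) r (nat \<lceil>(1 - 4 * \<epsilon>) * real (D n)\<rceil>) S x)
                          (f S x) (poly q (K + D n + n)))))))"
proof (intro conjI allI impI; (elim conjE)?)
  fix G :: "('a, 'b) bigraph" and D r K :: nat and \<epsilon> :: real
  assume G: "bipartite G" "left_degree G D" "bounded_right_degree G D r K \<epsilon>"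
    and r: "1 \<le> r" and K: "1 \<le> K" and eps: "0 < \<epsilon>"
  have "\<forall>x. \<exists>xs. mset xs = neighbors G x" using ex_mset by blast
  then obtain nbs where "\<And>x. mset (nbs x) = neighbors G x" by metis
  then show "admits_online_matching G ((1 - 4 * \<epsilon>) * real D)
      (2 * max 1 (nat \<lceil>log 2 (real K)\<rceil>) * r) K"
    unfolding admits_online_matching_def
    using online_matching_levels_of[OF G r K eps] by blast
next
  fix I :: "nat set" and G :: "nat \<Rightarrow> (bool list, bool list) bigraph" and D :: "nat \<Rightarrow> nat"
  assume family: "explicit_family I G D"
  obtain P and q :: "nat poly" and nbs where
    nbs: "\<And>n x. n \<in> I \<Longrightarrow> x \<in> left (G n) \<Longrightarrow> mset (nbs n x) = neighbors (G n) x"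
    and P: "\<And>n r K l S x. n \<in> I \<Longrightarrow> 1 \<le> r \<Longrightarrow> l \<le> D n \<Longrightarrow> set S \<subseteq> left (G n) \<Longrightarrow>
      length S \<le> K \<Longrightarrow> x \<in> left (G n) \<Longrightarrow>
      computes_multiset_within P (matching_input K (D n) r l S x)
        (mset (assigned (levels_of r l (nbs n) S) x)) (poly q (K + D n + n))"
    using matching_program[OF family] by metis
  show "\<exists>(P :: com) (q :: nat poly).
           \<forall>n\<in>I. \<forall>(r :: nat) (K :: nat) (\<epsilon> :: real).
             1 \<le> r \<and> 1 \<le> K \<and> 0 < \<epsilon> \<and> bounded_right_degree (G n) (D n) r K \<epsilon> \<longrightarrow>
             (\<exists>f. online_matching_fun (G n) ((1 - 4 * \<epsilon>) * real (D n))
                    (2 * max 1 (nat \<lceil>log 2 (real K)\<rceil>) * r) K f \<and>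
                  (\<forall>S. set S \<subseteq> left (G n) \<and> length S \<le> K \<longrightarrow>
                     (\<forall>x\<in>left (G n).
                        computes_multiset_within P
                          (matching_input K (D n) r (nat \<lceil>(1 - 4 * \<epsilon>) * real (D n)\<rceil>) S x)
                          (f S x) (poly q (K + D n + n)))))"
  proof (intro exI[of _ P] exI[of _ q] ballI allI impI; elim conjE)
    fix n r K :: nat and \<epsilon> :: real
    assume n: "n \<in> I" and r: "1 \<le> r" and K: "1 \<le> K" and eps: "0 < \<epsilon>"
      and brd: "bounded_right_degree (G n) (D n) r K \<epsilon>"
    let ?l = "nat \<lceil>(1 - 4 * \<epsilon>) * real (D n)\<rceil>"
    \<comment> \<open>\<open>nbs\<close> was fixed together with the program, before
      \<open>r\<close>, \<open>K\<close> and \<open>\<epsilon>\<close>; the function depends on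
      \<open>\<epsilon>\<close> only through \<open>?l\<close>. For \<open>\<epsilon>\<close> above
      1/4 this is 0, and condition (4) is vacuous.\<close>
    let ?f = "\<lambda>S x. mset (assigned (levels_of r ?l (nbs n) S) x)"
    have "bipartite (G n)" "left_degree (G n) (D n)"
      using family n unfolding explicit_family_def by blast+
    then have "online_matching_fun (G n) ((1 - 4 * \<epsilon>) * real (D n))
        (2 * max 1 (nat \<lceil>log 2 (real K)\<rceil>) * r) K ?f"
      using online_matching_levels_of[OF _ _ brd r K eps] nbs[OF n] by blast
    moreover have "(1 - 4 * \<epsilon>) * real (D n) \<le> real (D n)" using eps by (simp add: algebra_simps)
    then have "?l \<le> D n" by linarith
    ultimately show "\<exists>f. online_matching_fun (G n) ((1 - 4 * \<epsilon>) * real (D n))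
          (2 * max 1 (nat \<lceil>log 2 (real K)\<rceil>) * r) K f \<and>
        (\<forall>S. set S \<subseteq> left (G n) \<and> length S \<le> K \<longrightarrow>
           (\<forall>x\<in>left (G n).
              computes_multiset_within P (matching_input K (D n) r ?l S x)
                (f S x) (poly q (K + D n + n))))"
      using P[OF n r] by (intro exI[of _ ?f]) blast
  qed
qed

end
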